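(* Let $A$ be an Abelian group of cardinality $|A|=\mathbf{m}$, where $\mathbf{m}$ is an infinite cardinal. Then, on $A$, there are precisely $2^{2^{\mathbf{m}}}$ totally bounded Hausdorff group topologies. Among them there are $2^{2^{\mathbf{m}}}$ pairwise nonhomeomorphic topologies.
   Context: A group topology $\tau$ on an Abelian group $A$ is totally bounded if for every neighborhood $U$ of zero there is a finite set $\{0,g_1,\dots,g_k\}\subset A$ such that $U, g_1+U,\dots,g_k+U$ cover $A$. Two topologies on $A$ are nonhomeomorphic if there is no homeomorphism (not necessarily consistent with the group structure) between the corresponding topological spaces. *)

theory Defs
  imports "HOL-Analysis.Analysis" "HOL-Algebra.Coset" "HOL-Library.Equipollence"
begin

text \<open>
  Groups are written multiplicatively, following HOL-Algebra: the zero of the Abelian group is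
  \<open>\<one>\<^bsub>G\<^esub>\<close> and the translate \<open>g + U\<close> is \<open>g <#\<^bsub>G\<^esub> U\<close>. Topologies on the group are abstract topologies
  whose underlying space is exactly the carrier.
\<close>

definition group_topology :: "('a, 'b) monoid_scheme \<Rightarrow> 'a topology \<Rightarrow> bool" where
  "group_topology G T \<longleftrightarrow>
     topspace T = carrier G \<and>
     continuous_map (prod_topology T T) T (\<lambda>(x, y). x \<otimes>\<^bsub>G\<^esub> y) \<and>
     continuous_map T T (\<lambda>x. inv\<^bsub>G\<^esub> x)"

text \<open>Neighbourhoods need not be open.\<close>

definition neighbourhood_in :: "'a topology \<Rightarrow> 'a \<Rightarrow> 'a set \<Rightarrow> bool" where
  "neighbourhood_in T x U \<longleftrightarrow> U \<subseteq> topspace T \<and> (\<exists>V. openin T V \<and> x \<in> V \<and> V \<subseteq> U)"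

definition totally_bounded_topology :: "('a, 'b) monoid_scheme \<Rightarrow> 'a topology \<Rightarrow> bool" where
  "totally_bounded_topology G T \<longleftrightarrow>
     (\<forall>U. neighbourhood_in T \<one>\<^bsub>G\<^esub> U \<longrightarrow>
        (\<exists>F. finite F \<and> F \<subseteq> carrier G \<and> \<one>\<^bsub>G\<^esub> \<in> F \<and> carrier G \<subseteq> (\<Union>g\<in>F. g <#\<^bsub>G\<^esub> U)))"

definition tb_Hausdorff_group_topologies :: "('a, 'b) monoid_scheme \<Rightarrow> 'a topology set" where
  "tb_Hausdorff_group_topologies G =
     {T. group_topology G T \<and> totally_bounded_topology G T \<and> Hausdorff_space T}"

end

theory Submission
  imports Defs "HOL-Algebra.Generated_Groups" "HOL-Real_Asymp.Real_Asymp"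
begin

text \<open>
  Write \<open>A\<close> for the group and \<open>X\<close> for its group of characters into the unit circle. A set \<open>B\<close> of
  characters induces a totally bounded group topology, which is Hausdorff if \<open>B\<close> separates points,
  and a character that is continuous in it belongs to the subgroup generated by \<open>B\<close> (Comfort and
  Ross). Gluing characters along a well-order of \<open>A\<close> shows that \<open>X\<close> has at least \<open>2^|A|\<close>
  elements, while \<open>|A|\<close> of them suffice to separate points. Modulo the subgroup \<open>S\<close> generated by
  such a small separating set, \<open>X\<close> contains an independent set \<open>I\<close> with \<open>2^|A|\<close> elements, and
  the topologies induced by \<open>S \<union> Y\<close> for \<open>Y \<subseteq> I\<close> are pairwise distinct. A homeomorphism class of
  topologies on \<open>A\<close> has at most \<open>2^|A|\<close> members, because each of them is the image of one fixed
  member under a bijection of \<open>A\<close>; hence there are as many classes as topologies.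
\<close>

section \<open>Independent sets in Abelian groups\<close>

text \<open>Cardinals are compared through injections between sets, with the carrier for |A| and
  \<open>Pow\<close> for exponentiation with base 2. Two demands pull in opposite directions: each
  topology has to be Hausdorff, so each family of characters must separate points, yet the families
  must stay independent of one another. Hence independence is measured modulo \<open>S\<close>.
  Characters may have finite order, so \<open>I\<close> is no basis; it only has the property that
  each character outside \<open>S\<close> has a power in the subgroup generated by \<open>S\<close>
  and \<open>I\<close> that is not in \<open>S\<close>. Counting roots shows that this is enough.
  For the theorem of Comfort and Ross, finite averages over group elements imitate an invariant mean
  and make finitely many nontrivial characters almost vanish in the mean. A random walk on a
  finitely generated group of characters returns too often, by polynomial growth, for a character
  outside that group to have real part at least 1/2 wherever the generators are near 1.\<close>

lemma lepoll_iff_card_of: "A \<lesssim> B \<longleftrightarrow> ordLeq3 (card_of A) (card_of B)"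
  by (simp add: lepoll_def card_of_ordLeq)

lemma lepoll_linear: "A \<lesssim> B \<or> B \<lesssim> A"
  by (simp add: lepoll_iff_card_of ordLeq_total card_of_Well_order)

lemma UN_lepoll_infinite:
  assumes "infinite Z" "I \<lesssim> Z" "\<And>i. i \<in> I \<Longrightarrow> A i \<lesssim> Z"
  shows "(\<Union>i\<in>I. A i) \<lesssim> Z"
  using card_of_UNION_ordLeq_infinite[of Z I A] assms by (simp add: lepoll_iff_card_of)

lemma Un_lepoll_infinite:
  assumes "infinite Z" "A \<lesssim> Z" "B \<lesssim> Z"
  shows "A \<union> B \<lesssim> Z"
proof -
  have "(\<Union>b\<in>{True, False}. if b then A else B) \<lesssim> Z"
    using assms by (intro UN_lepoll_infinite) (auto simp: finite_lepoll_infinite)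
  then show ?thesis by (simp add: Un_commute)
qed

lemma Times_lepoll_infinite:
  assumes "infinite Z" "A \<lesssim> Z" "B \<lesssim> Z"
  shows "A \<times> B \<lesssim> Z"
proof -
  have "A \<times> B = (\<Union>a\<in>A. Pair a ` B)" by auto
  moreover have "\<dots> \<lesssim> Z"
    using assms by (intro UN_lepoll_infinite) (auto intro: lepoll_trans[OF image_lepoll])
  ultimately show ?thesis by simp
qed

lemma countable_lepoll_infinite:
  assumes "infinite Z" "countable A"
  shows "A \<lesssim> Z"
proof -
  have "A \<lesssim> (UNIV :: nat set)" using assms(2) by (auto simp: countable_def lepoll_def)
  also have "\<dots> \<lesssim> Z" using assms(1) by (simp add: infinite_le_lepoll)
  finally show ?thesis .
qed

text \<open>Meant for power maps, where the image and all fibres have a known bound.\<close>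

lemma lepoll_infinite_fibres:
  assumes "infinite Z" "f ` A \<lesssim> Z" "\<And>y. y \<in> f ` A \<Longrightarrow> {x \<in> A. f x = y} \<lesssim> Z"
  shows "A \<lesssim> Z"
proof -
  have "(\<Union>y\<in>f ` A. {x \<in> A. f x = y}) \<lesssim> Z" using assms by (intro UN_lepoll_infinite)
  moreover have "(\<Union>y\<in>f ` A. {x \<in> A. f x = y}) = A" by auto
  ultimately show ?thesis by simp
qed

section \<open>Generated subgroups and independence modulo a subgroup\<close>

lemma (in group) generate_lepoll:
  assumes "infinite Z" "B \<subseteq> carrier G" "B \<lesssim> Z"
  shows "generate G B \<lesssim> Z"
proof -
  \<comment> \<open>\<open>E n\<close> holds the products of 2^n factors taken from
    \<open>B\<close>, its inverses and \<open>\<one>\<close>. Lengths double at each level because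
    the rule \<open>eng\<close> multiplies two arbitrary members; the unit among the factors makes
    the levels increase.\<close>
  define E where "E = rec_nat (insert \<one> (B \<union> m_inv G ` B)) (\<lambda>_ X. (\<lambda>(x, y). x \<otimes> y) ` (X \<times> X))"
  have E0: "E 0 = insert \<one> (B \<union> m_inv G ` B)" and
    ES: "E (Suc n) = (\<lambda>(x, y). x \<otimes> y) ` (E n \<times> E n)" for n
    by (simp_all add: E_def)
  have carr: "E n \<subseteq> carrier G" for n
    using assms(2) by (induction n) (auto simp: E0 ES)
  have one: "\<one> \<in> E n" for n
    by (induction n) (force simp: E0 ES)+
  have mono1: "E n \<subseteq> E (Suc n)" for n
  proof
    fix x assume "x \<in> E n"
    then have "(x, \<one>) \<in> E n \<times> E n" "x = (\<lambda>(x, y). x \<otimes> y) (x, \<one>)"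
      using one subsetD[OF carr] by auto
    then show "x \<in> E (Suc n)" unfolding ES by blast
  qed
  have mono: "m \<le> n \<Longrightarrow> E m \<subseteq> E n" for m n
    using lift_Suc_mono_le[of E, OF mono1] by blast
  have "E n \<lesssim> Z" for n
  proof (induction n)
    case 0
    have "B \<union> m_inv G ` B \<lesssim> Z"
      by (intro Un_lepoll_infinite assms lepoll_trans[OF image_lepoll assms(3)])
    then have "{\<one>} \<union> (B \<union> m_inv G ` B) \<lesssim> Z"
      by (rule Un_lepoll_infinite[OF assms(1) finite_lepoll_infinite[OF assms(1)], rotated]) auto
    then show ?case by (simp add: E0)
  next
    case (Suc n)
    then show ?case unfolding ES
      by (intro lepoll_trans[OF image_lepoll] Times_lepoll_infinite[OF assms(1)])
  qed
  then have "(\<Union>n. E n) \<lesssim> Z"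
    by (intro UN_lepoll_infinite[OF assms(1) countable_lepoll_infinite[OF assms(1)]]) auto
  moreover have "generate G B \<subseteq> (\<Union>n. E n)"
  proof
    fix x assume "x \<in> generate G B"
    then show "x \<in> (\<Union>n. E n)"
    proof (induction rule: generate.induct)
      case one
      then show ?case using E0 by blast
    next
      case (incl h)
      then show ?case using E0 by blast
    next
      case (inv h)
      then show ?case using E0 by blast
    next
      case (eng h1 h2)
      then obtain m n where "h1 \<in> E m" "h2 \<in> E n" by blast
      then have "(h1, h2) \<in> E (max m n) \<times> E (max m n)"
        using mono[of m "max m n"] mono[of n "max m n"] by auto
      then have "(\<lambda>(x, y). x \<otimes> y) (h1, h2) \<in> E (Suc (max m n))" unfolding ES by (rule imageI)
      then have "h1 \<otimes> h2 \<in> E (Suc (max m n))" by simp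
      then show ?case by blast
    qed
  qed
  ultimately show ?thesis by (blast intro: lepoll_trans[OF subset_imp_lepoll])
qed

text \<open>Reduces membership in the subgroup generated by the union of a chain to one member of
  the chain. \<open>G\<close> is an arbitrary structure here, hence the separate induction for
  monotonicity inside.\<close>

lemma generate_finitary:
  assumes "x \<in> generate G B"
  shows "\<exists>F. finite F \<and> F \<subseteq> B \<and> x \<in> generate G F"
  using assms
proof (induction rule: generate.induct)
  case one
  then show ?case by (intro exI[of _ "{}"]) (auto intro: generate.intros)
next
  case (incl h)
  then show ?case by (intro exI[of _ "{h}"]) (auto intro: generate.intros)
next
  case (inv h)
  then show ?case by (intro exI[of _ "{h}"]) (auto intro: generate.intros)
next
  case (eng h1 h2)
  then obtain F1 F2 where F: "finite F1" "F1 \<subseteq> B" "h1 \<in> generate G F1"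
      "finite F2" "F2 \<subseteq> B" "h2 \<in> generate G F2" by blast
  have mono: "x \<in> generate G K \<Longrightarrow> K \<subseteq> K' \<Longrightarrow> x \<in> generate G K'" for x K K'
    by (induction rule: generate.induct) (auto intro: generate.intros)
  have "h1 \<in> generate G (F1 \<union> F2)" "h2 \<in> generate G (F1 \<union> F2)" using F mono by auto
  then have "h1 \<otimes>\<^bsub>G\<^esub> h2 \<in> generate G (F1 \<union> F2)" by (rule generate.eng)
  then show ?case using F by (intro exI[of _ "F1 \<union> F2"]) auto
qed

text \<open>Commutativity gathers all occurrences of \<open>y\<close> in one integer power. This
  normal form drives both the exchange argument for independent sets and the extension of characters
  by one element.\<close>

lemma (in comm_group) generate_insert:
  assumes "B \<subseteq> carrier G" "y \<in> carrier G"
  shows "generate G (insert y B) = {d \<otimes> y [^] k |d k. d \<in> generate G B \<and> k \<in> (UNIV :: int set)}"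
    (is "_ = ?R")
proof
  have dB: "subgroup (generate G B) G" by (rule generate_is_subgroup[OF assms(1)])
  note carr = subgroup.mem_carrier[OF dB]
  have "subgroup ?R G"
  proof
    show "?R \<subseteq> carrier G" using carr assms(2) by auto
    show "\<one> \<in> ?R" using generate.one[of G B] by (intro CollectI exI[of _ \<one>] exI[of _ "0::int"]) auto
  next
    fix u v assume "u \<in> ?R" "v \<in> ?R"
    then obtain d k e l where *: "u = d \<otimes> y [^] (k::int)" "v = e \<otimes> y [^] (l::int)"
      "d \<in> generate G B" "e \<in> generate G B" by auto
    then have "u \<otimes> v = (d \<otimes> e) \<otimes> y [^] (k + l)"
      using carr assms(2) by (simp add: int_pow_mult m_ac)
    moreover have "d \<otimes> e \<in> generate G B" using * by (simp add: generate.eng)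
    ultimately show "u \<otimes> v \<in> ?R" by blast
  next
    fix u assume "u \<in> ?R"
    then obtain d k where *: "u = d \<otimes> y [^] (k::int)" "d \<in> generate G B" by auto
    then have "inv u = inv d \<otimes> y [^] (- k)"
      using carr assms(2) by (simp add: int_pow_neg inv_mult)
    moreover have "inv d \<in> generate G B" using * subgroup.m_inv_closed[OF dB] by simp
    ultimately show "inv u \<in> ?R" by blast
  qed
  moreover have "insert y B \<subseteq> ?R"
  proof -
    have "y = \<one> \<otimes> y [^] (1::int)" using assms by simp
    then have "y \<in> ?R" using generate.one by blast
    moreover have "b \<in> ?R" if "b \<in> B" for b
    proof -
      have "b = b \<otimes> y [^] (0::int)" using assms that by auto
      then show ?thesis using generate.incl[OF that] by blast
    qed
    ultimately show ?thesis by blast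
  qed
  ultimately show "generate G (insert y B) \<subseteq> ?R" by (intro generate_subgroup_incl)
  have sg: "subgroup (generate G (insert y B)) G" using assms by (intro generate_is_subgroup) auto
  have "y \<in> generate G (insert y B)" by (auto intro: generate.incl)
  moreover have "generate G B \<subseteq> generate G (insert y B)" by (rule mono_generate) auto
  ultimately show "?R \<subseteq> generate G (insert y B)"
    using subgroup.m_closed[OF sg] subgroup_int_pow_closed[OF sg] by auto
qed

text \<open>For a subgroup \<open>S\<close>, this is independence of the images of \<open>I\<close>
  in the quotient by \<open>S\<close>, expressed without forming the quotient. Torsion is allowed,
  so a relation forces the power into \<open>S\<close> rather than the exponent to be 0.\<close>

definition independent_mod :: "('a, 'b) monoid_scheme \<Rightarrow> 'a set \<Rightarrow> 'a set \<Rightarrow> bool" where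
  "independent_mod G S I \<longleftrightarrow> I \<subseteq> carrier G - S \<and>
     (\<forall>x\<in>I. \<forall>k::int. x [^]\<^bsub>G\<^esub> k \<in> generate G (S \<union> (I - {x})) \<longrightarrow> x [^]\<^bsub>G\<^esub> k \<in> S)"

lemma (in group) independent_modD:
  assumes "independent_mod G S I" "Y \<subseteq> I" "x \<in> I" "x \<notin> Y"
  shows "x \<notin> generate G (S \<union> Y)"
proof
  assume "x \<in> generate G (S \<union> Y)"
  moreover have "generate G (S \<union> Y) \<subseteq> generate G (S \<union> (I - {x}))"
    using assms by (intro mono_generate) auto
  moreover have "x \<in> carrier G" "x \<notin> S" using assms by (auto simp: independent_mod_def)
  ultimately have "x [^] (1::int) \<in> S"
    using assms unfolding independent_mod_def by (metis int_pow_1 subsetD)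
  then show False using \<open>x \<in> carrier G\<close> \<open>x \<notin> S\<close> by simp
qed

text \<open>Zorn's lemma together with an exchange argument. A maximal independent set need not
  generate the group, even modulo \<open>S\<close>: of each \<open>y\<close> only some power,
  nontrivial modulo \<open>S\<close>, is captured.\<close>

lemma (in comm_group) maximal_independent_mod:
  assumes S: "subgroup S G"
  obtains I where "independent_mod G S I"
    "\<And>y. y \<in> carrier G - S \<Longrightarrow> \<exists>k::int. y [^] k \<in> generate G (S \<union> I) - S"
proof -
  have Sc: "S \<subseteq> carrier G" using S by (rule subgroup.subset)
  let ?A = "{I. independent_mod G S I}"
  have "\<exists>M\<in>?A. \<forall>X\<in>?A. M \<subseteq> X \<longrightarrow> X = M"
  proof (rule subset_Zorn')
    fix C assume C: "subset.chain ?A C"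
    have "x [^] k \<in> S" if x: "x \<in> \<Union>C" and k: "x [^] k \<in> generate G (S \<union> (\<Union>C - {x}))" for x and k :: int
    proof -
      obtain F where F: "finite F" "F \<subseteq> S \<union> (\<Union>C - {x})" "x [^] k \<in> generate G F"
        using generate_finitary[OF k] by blast
      \<comment> \<open>Finitely many elements take part in the relation, so one member of the chain
        contains them all; the chain is nonempty because \<open>x\<close> lies in its union.\<close>
      have "insert x (F - S) \<subseteq> \<Union>C" "finite (insert x (F - S))" "C \<noteq> {}" using F x by auto
      then obtain I where I: "I \<in> C" "insert x (F - S) \<subseteq> I"
        using C finite_subset_Union_chain[of "insert x (F - S)" C ?A] by blast
      then have "F \<subseteq> S \<union> (I - {x})" using F(2) by auto
      then have "x [^] k \<in> generate G (S \<union> (I - {x}))" using F(3) mono_generate by blast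
      moreover have "independent_mod G S I" using C I by (auto simp: subset.chain_def)
      ultimately show ?thesis using I by (auto simp: independent_mod_def)
    qed
    then show "\<Union>C \<in> ?A" using C by (auto simp: independent_mod_def subset.chain_def)
  qed
  then obtain I where I: "independent_mod G S I"
    and max: "\<And>X. independent_mod G S X \<Longrightarrow> I \<subseteq> X \<Longrightarrow> X = I" by blast
  have Ic: "I \<subseteq> carrier G" "I \<inter> S = {}" using I by (auto simp: independent_mod_def)
  have D: "subgroup (generate G (S \<union> I)) G" using Sc Ic by (intro generate_is_subgroup) auto
  have ess: "\<exists>k::int. y [^] k \<in> generate G (S \<union> I) - S" if y: "y \<in> carrier G - S" for y
  proof (cases "y \<in> I")
    case True
    then have "y [^] (1::int) \<in> generate G (S \<union> I) - S" using y by (auto intro: generate.incl)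
    then show ?thesis by blast
  next
    case False
    then have "\<not> independent_mod G S (insert y I)" using max by blast
    \<comment> \<open>The relation created by adding \<open>y\<close> may be witnessed at
      \<open>y\<close> itself or at an old element \<open>x\<close>; in the second case it is solved
      for a power of \<open>y\<close>.\<close>
    then have "\<exists>x\<in>insert y I. \<exists>k::int. x [^] k \<in> generate G (S \<union> (insert y I - {x})) - S"
      using y Ic unfolding independent_mod_def by blast
    then obtain x k where x: "x \<in> insert y I"
      and k: "x [^] (k::int) \<in> generate G (S \<union> (insert y I - {x})) - S"
      by blast
    show ?thesis
    proof (cases "x = y")
      case True
      then have "insert y I - {x} = I" using False by auto
      then show ?thesis using k True by auto
    next
      case xy: False
      then have xI: "x \<in> I" and xc: "x \<in> carrier G" using x Ic by auto
      have "S \<union> (insert y I - {x}) = insert y (S \<union> (I - {x}))" using xy by auto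
      then have "x [^] k \<in> generate G (insert y (S \<union> (I - {x})))" using k by simp
      moreover have cc: "S \<union> (I - {x}) \<subseteq> carrier G" using Sc Ic by auto
      ultimately obtain d j where d: "d \<in> generate G (S \<union> (I - {x}))" and
        eq: "x [^] k = d \<otimes> y [^] (j::int)"
        using y generate_insert[OF cc, of y] by auto
      have sub: "generate G (S \<union> (I - {x})) \<subseteq> generate G (S \<union> I)" by (rule mono_generate) auto
      have sg: "subgroup (generate G (S \<union> (I - {x}))) G" by (rule generate_is_subgroup[OF cc])
      have dc: "d \<in> carrier G" using sg d by (rule subgroup.mem_carrier)
      have "y [^] j = inv d \<otimes> x [^] k" using eq dc y by (simp add: m_assoc[symmetric])
      moreover have "x [^] k \<in> generate G (S \<union> I)"
        using xI by (intro subgroup_int_pow_closed[OF D]) (auto intro: generate.incl)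
      ultimately have "y [^] j \<in> generate G (S \<union> I)"
        using d sub subgroup.m_inv_closed[OF D] subgroup.m_closed[OF D] by auto
      \<comment> \<open>Otherwise the relation would involve only \<open>S\<close> and
        \<open>I - {x}\<close>, against the independence of \<open>I\<close>.\<close>
      moreover have "y [^] j \<notin> S"
      proof
        assume "y [^] j \<in> S"
        then have "y [^] j \<in> generate G (S \<union> (I - {x}))" by (auto intro: generate.incl)
        then have "x [^] k \<in> generate G (S \<union> (I - {x}))" using eq d generate.eng by metis
        then show False using I xI k by (auto simp: independent_mod_def)
      qed
      ultimately show ?thesis by blast
    qed
  qed
  show thesis using that I ess by blast
qed

section \<open>Cardinality of essential extensions\<close>

lemma (in comm_group) nat_pow_fibre_lepoll:
  assumes "subgroup S G"
  shows "{y \<in> carrier G. y [^] (n::nat) = d} \<lesssim> {y \<in> carrier G. y [^] n \<in> S}"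
proof (cases "\<exists>z. z \<in> carrier G \<and> z [^] n = d")
  case True
  then obtain z where z: "z \<in> carrier G" "z [^] n = d" by blast
  \<comment> \<open>Dividing by one root \<open>z\<close> of \<open>d\<close> turns all roots of
    \<open>d\<close> into roots of \<open>\<one>\<close>, which belongs to \<open>S\<close>.\<close>
  have "(y \<otimes> inv z) [^] n = \<one>" if "y \<in> carrier G" "y [^] n = d" for y
    using that z nat_pow_closed[of z n] by (simp add: nat_pow_distrib nat_pow_inv)
  then have "(\<lambda>y. y \<otimes> inv z) ` {y \<in> carrier G. y [^] n = d} \<subseteq> {y \<in> carrier G. y [^] n \<in> S}"
    using z subgroup.one_closed[OF assms] by auto
  moreover have "inj_on (\<lambda>y. y \<otimes> inv z) {y \<in> carrier G. y [^] n = d}"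
    using z by (auto simp: inj_on_def)
  ultimately show ?thesis unfolding lepoll_def by blast
next
  case False
  then have "{y \<in> carrier G. y [^] n = d} = {}" by auto
  then show ?thesis by (metis empty_lepoll)
qed

text \<open>The elements of prime order modulo \<open>S\<close> already lie in \<open>D\<close>, and these control the fibres of all
  power maps.\<close>

lemma (in comm_group) essential_extension_lepoll:
  assumes Z: "infinite Z" and S: "subgroup S G" and D: "subgroup D G" "S \<subseteq> D" "D \<lesssim> Z"
    and ess: "\<And>y. y \<in> carrier G - S \<Longrightarrow> \<exists>k::int. y [^] k \<in> D - S"
  shows "carrier G \<lesssim> Z"
proof -
  define E where "E n = {y \<in> carrier G. y [^] (n::nat) \<in> S}" for n
  have prime_E: "E p \<lesssim> Z" if p: "prime p" for p :: nat
  proof -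
    have "y \<in> D" if y: "y \<in> E p" for y
    proof (cases "y \<in> S")
      case True
      then show ?thesis using D by auto
    next
      case False
      have yc: "y \<in> carrier G" and yp: "y [^] int p \<in> S" using y by (auto simp: E_def int_pow_int)
      obtain k :: int where k: "y [^] k \<in> D - S" using ess[of y] yc False by auto
      \<comment> \<open>If \<open>p\<close> divided \<open>k\<close>, then \<open>y [^] k\<close>
        would be a power of \<open>y [^] p\<close> and lie in \<open>S\<close>. Bezout then recovers
        \<open>y\<close> itself from two of its powers that lie in \<open>D\<close>.\<close>
      have "\<not> int p dvd k"
      proof
        assume "int p dvd k"
        then obtain j where "k = int p * j" by auto
        then have "y [^] k = (y [^] int p) [^] j" using yc by (simp add: int_pow_pow)
        then show False using k subgroup_int_pow_closed[OF S yp] by auto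
      qed
      then have "coprime (int p) k" using p by (simp add: prime_imp_coprime)
      then obtain u v where uv: "u * int p + v * k = 1"
        using bezout_int[of "int p" k] by (auto simp: coprime_iff_gcd_eq_1)
      have "y = y [^] (u * int p + v * k)" using uv yc by simp
      also have "\<dots> = (y [^] int p) [^] u \<otimes> (y [^] k) [^] v"
        using yc by (simp add: int_pow_mult int_pow_pow mult.commute del: int_pow_int)
      finally show ?thesis
        using subgroup_int_pow_closed[OF D(1)] k yp D(2) subgroup.m_closed[OF D(1)]
        by (metis DiffD1 subsetD)
    qed
    then show ?thesis using D(3) subset_imp_lepoll lepoll_trans by (metis subsetI)
  qed
  have E: "E n \<lesssim> Z" if "n > 0" for n
    using that
  proof (induction n rule: less_induct)
    case (less n)
    show ?case
    proof (cases "n = 1")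
      case True
      then have "E n \<subseteq> D" using D by (auto simp: E_def)
      then show ?thesis using D(3) subset_imp_lepoll lepoll_trans by metis
    next
      case False
      then obtain p where p: "prime p" "p dvd n" using prime_factor_nat by blast
      then obtain m where m: "n = p * m" by auto
      then have "m > 0" "m < n" using less.prems prime_gt_1_nat[OF p(1)] by auto
      then have Em: "E m \<lesssim> Z" using less.IH by blast
      \<comment> \<open>One prime is peeled off: the \<open>p\<close>-th power maps
        \<open>E n\<close> into \<open>E m\<close>, and its fibres are no larger than
        \<open>E p\<close>.\<close>
      have "(\<lambda>y. y [^] p) ` E n \<subseteq> E m" using m by (auto simp: E_def nat_pow_pow)
      then have 1: "(\<lambda>y. y [^] p) ` E n \<lesssim> Z" using Em subset_imp_lepoll lepoll_trans by metis
      have 2: "{x \<in> E n. x [^] p = y} \<lesssim> Z" for y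
      proof -
        have "{x \<in> E n. x [^] p = y} \<lesssim> {x \<in> carrier G. x [^] p = y}"
          by (rule subset_imp_lepoll) (auto simp: E_def)
        also have "\<dots> \<lesssim> E p" unfolding E_def by (rule nat_pow_fibre_lepoll[OF S])
        finally show ?thesis using prime_E[OF p(1)] lepoll_trans by blast
      qed
      show ?thesis by (rule lepoll_infinite_fibres[OF Z 1]) (rule 2)
    qed
  qed
  \<comment> \<open>Outside \<open>S\<close> every element is a root of some element of
    \<open>D\<close>; inversion makes the exponent positive. The fibres are thus indexed by
    countably many exponents and the elements of \<open>D\<close>.\<close>
  have "carrier G \<subseteq> S \<union> (\<Union>n\<in>{0<..}. \<Union>d\<in>D. {y \<in> carrier G. y [^] (n::nat) = d})"
  proof
    fix y assume y: "y \<in> carrier G"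
    show "y \<in> S \<union> (\<Union>n\<in>{0<..}. \<Union>d\<in>D. {y \<in> carrier G. y [^] (n::nat) = d})"
    proof (cases "y \<in> S")
      case False
      then obtain k :: int where k: "y [^] k \<in> D - S" using ess y by blast
      have "k \<noteq> 0" using k subgroup.one_closed[OF S] by auto
      have "y [^] nat \<bar>k\<bar> \<in> D"
      proof (cases "k \<ge> 0")
        case True
        then show ?thesis using k by (simp add: pow_nat)
      next
        case False
        then have "y [^] nat \<bar>k\<bar> = inv (y [^] k)"
          using y by (metis abs_of_neg int_nat_eq int_pow_int int_pow_neg linorder_not_le minus_minus inv_inv int_pow_closed abs_ge_zero)
        then show ?thesis using k subgroup.m_inv_closed[OF D(1)] by auto
      qed
      moreover have "nat \<bar>k\<bar> \<in> {0<..}" using \<open>k \<noteq> 0\<close> by simp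
      ultimately show ?thesis using y by blast
    qed auto
  qed
  moreover have "S \<union> (\<Union>n\<in>{0<..}. \<Union>d\<in>D. {y \<in> carrier G. y [^] (n::nat) = d}) \<lesssim> Z"
  proof (intro Un_lepoll_infinite[OF Z] UN_lepoll_infinite[OF Z] D(3))
    show "S \<lesssim> Z" using D subset_imp_lepoll lepoll_trans by metis
    show "{0::nat<..} \<lesssim> Z" by (rule countable_lepoll_infinite[OF Z]) auto
    fix n :: nat and d assume "n \<in> {0<..}"
    then show "{y \<in> carrier G. y [^] n = d} \<lesssim> Z"
      using nat_pow_fibre_lepoll[OF S, of n d] E[of n] lepoll_trans by (auto simp: E_def)
  qed
  ultimately show ?thesis by (rule lepoll_trans[OF subset_imp_lepoll])
qed

text \<open>The bound on essential extensions is applied twice. With \<open>Z\<close> it only shows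
  that \<open>I\<close> is strictly larger than \<open>Z\<close>, which may fall short of
  \<open>Pow Z\<close>; with \<open>I\<close> itself as the bound it shows that \<open>I\<close> is
  as large as the whole group.\<close>

lemma (in comm_group) independent_mod_large:
  assumes Z: "infinite Z" and S: "subgroup S G" "S \<lesssim> Z"
    and big: "Pow Z \<lesssim> carrier G"
  obtains I where "independent_mod G S I" "Pow Z \<lesssim> I"
proof -
  obtain I where I: "independent_mod G S I"
    and ess: "\<And>y. y \<in> carrier G - S \<Longrightarrow> \<exists>k::int. y [^] k \<in> generate G (S \<union> I) - S"
    using maximal_independent_mod[OF S(1)] by blast
  have c: "S \<union> I \<subseteq> carrier G" using subgroup.subset[OF S(1)] I by (auto simp: independent_mod_def)
  have D: "subgroup (generate G (S \<union> I)) G" "S \<subseteq> generate G (S \<union> I)"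
    using generate_is_subgroup[OF c] by (auto intro: generate.incl)
  have "\<not> I \<lesssim> Z"
  proof
    assume "I \<lesssim> Z"
    then have "generate G (S \<union> I) \<lesssim> Z" using Z S(2) c by (intro generate_lepoll Un_lepoll_infinite)
    then have "carrier G \<lesssim> Z" using essential_extension_lepoll[OF Z S(1) D] ess by blast
    then have "Pow Z \<lesssim> Z" using big lepoll_trans by blast
    then show False
      by (meson lesspoll_Pow_self lesspoll_not_refl lesspoll_trans1)
  qed
  then have ZI: "Z \<lesssim> I" using lepoll_linear by blast
  then have iI: "infinite I" using Z finite_lepoll_infinite
    by (meson countable_finite infinite_le_lepoll lepoll_trans)
  have "generate G (S \<union> I) \<lesssim> I"
    using iI c by (intro generate_lepoll Un_lepoll_infinite lepoll_trans[OF S(2) ZI]) auto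
  then have "carrier G \<lesssim> I" using essential_extension_lepoll[OF iI S(1) D] ess by blast
  then show thesis using that[OF I] big lepoll_trans by blast
qed

section \<open>Characters\<close>

text \<open>Characters take the value 1 outside the carrier, so that they are determined by their values on
  the group and multiply pointwise.\<close>

definition partial_characters :: "('a, 'b) monoid_scheme \<Rightarrow> 'a set \<Rightarrow> ('a \<Rightarrow> complex) set" where
  "partial_characters G H = {f. (\<forall>x. norm (f x) = 1) \<and> (\<forall>x. x \<notin> carrier G \<longrightarrow> f x = 1) \<and>
     (\<forall>x\<in>H. \<forall>y\<in>H. f (x \<otimes>\<^bsub>G\<^esub> y) = f x * f y)}"

abbreviation characters :: "('a, 'b) monoid_scheme \<Rightarrow> ('a \<Rightarrow> complex) set" where
  "characters G \<equiv> partial_characters G (carrier G)"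

definition dual :: "('a, 'b) monoid_scheme \<Rightarrow> ('a \<Rightarrow> complex) monoid" where
  "dual G = \<lparr>carrier = characters G, mult = (\<lambda>\<phi> \<psi> x. \<phi> x * \<psi> x), one = (\<lambda>_. 1)\<rparr>"

lemma dual_simps [simp]:
  "carrier (dual G) = characters G"
  "\<phi> \<otimes>\<^bsub>dual G\<^esub> \<psi> = (\<lambda>x. \<phi> x * \<psi> x)"
  "\<one>\<^bsub>dual G\<^esub> = (\<lambda>_. 1)"
  by (simp_all add: dual_def)

lemma partial_characters_norm: "f \<in> partial_characters G H \<Longrightarrow> norm (f x) = 1"
  by (simp add: partial_characters_def)

lemma partial_characters_nonzero: "f \<in> partial_characters G H \<Longrightarrow> f x \<noteq> 0"
  using partial_characters_norm[of f G H x] by auto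

lemma partial_characters_mult:
  "f \<in> partial_characters G H \<Longrightarrow> x \<in> H \<Longrightarrow> y \<in> H \<Longrightarrow> f (x \<otimes>\<^bsub>G\<^esub> y) = f x * f y"
  by (simp add: partial_characters_def)

lemma partial_characters_antimono:
  "H \<subseteq> K \<Longrightarrow> partial_characters G K \<subseteq> partial_characters G H"
  unfolding partial_characters_def by blast

lemma trivial_partial_character: "(\<lambda>_. 1) \<in> partial_characters G H"
  by (simp add: partial_characters_def)

lemma characters_times:
  "\<phi> \<in> characters G \<Longrightarrow> \<psi> \<in> characters G \<Longrightarrow> (\<lambda>x. \<phi> x * \<psi> x) \<in> characters G"
  by (simp add: partial_characters_def norm_mult)

lemma characters_inverse: "\<phi> \<in> characters G \<Longrightarrow> (\<lambda>x. inverse (\<phi> x)) \<in> characters G"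
  by (simp add: partial_characters_def norm_inverse)

lemma comm_group_dual: "comm_group (dual G)"
proof (rule comm_groupI)
  fix \<phi> assume "\<phi> \<in> carrier (dual G)"
  then show "\<exists>\<psi>\<in>carrier (dual G). \<psi> \<otimes>\<^bsub>dual G\<^esub> \<phi> = \<one>\<^bsub>dual G\<^esub>"
    using characters_inverse[of \<phi> G] partial_characters_nonzero[of \<phi> G]
    by (intro bexI[of _ "\<lambda>x. inverse (\<phi> x)"]) auto
qed (auto simp: characters_times trivial_partial_character mult_ac)

lemma inv_dual:
  assumes "\<phi> \<in> characters G"
  shows "inv\<^bsub>dual G\<^esub> \<phi> = (\<lambda>x. inverse (\<phi> x))"
proof -
  interpret D: comm_group "dual G" by (rule comm_group_dual)
  show ?thesis
    using assms characters_inverse[OF assms] partial_characters_nonzero[OF assms]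
    by (intro D.inv_equality) auto
qed

lemma nat_pow_dual: "\<phi> [^]\<^bsub>dual G\<^esub> (n::nat) = (\<lambda>x. \<phi> x ^ n)"
  by (induction n) (auto simp: mult.commute)

section \<open>Compactness in the space of unimodular functions\<close>

lemma compact_unitary_functions: "compact {f :: 'a \<Rightarrow> complex. \<forall>x. norm (f x) = 1}"
proof -
  have "compactin (product_topology (\<lambda>_. euclidean) (UNIV :: 'a set)) (\<Pi>\<^sub>E x\<in>UNIV. sphere (0::complex) 1)"
    by (simp add: compactin_PiE)
  moreover have "(\<Pi>\<^sub>E x\<in>UNIV. sphere (0::complex) 1) = {f :: 'a \<Rightarrow> complex. \<forall>x. norm (f x) = 1}"
    by (auto simp: PiE_def Pi_def)
  ultimately show ?thesis by (simp add: euclidean_product_topology)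
qed

lemma continuous_on_eval [continuous_intros]: "continuous_on A (\<lambda>f :: 'a \<Rightarrow> 'b::topological_space. f x)"
  by (rule continuous_on_subset[OF continuous_on_product_coordinates]) auto

text \<open>Partial characters are total functions whose multiplicativity is required on
  \<open>H\<close> only. So they live in one product space for all \<open>H\<close>, and each
  condition is an equation between finitely many coordinates.\<close>

lemma closed_partial_characters: "closed (partial_characters G H)"
proof -
  have "partial_characters G H = {f. \<forall>x. norm (f x) = 1} \<inter> (\<Inter>x\<in>-carrier G. {f. f x = 1}) \<inter>
     (\<Inter>x\<in>H. \<Inter>y\<in>H. {f. f (x \<otimes>\<^bsub>G\<^esub> y) = f x * f y})"
    by (auto simp: partial_characters_def)
  also have "closed \<dots>"
    by (intro closed_Int closed_INT ballI closed_Collect_all closed_Collect_eq continuous_intros)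
  finally show ?thesis .
qed

lemma closed_agreeing_functions:
  fixes f :: "'a \<Rightarrow> 'b::t2_space"
  shows "closed {g. \<forall>x\<in>H. g x = f x}"
proof -
  have "{g. \<forall>x\<in>H. g x = f x} = (\<Inter>x\<in>H. {g. g x = f x})" by auto
  also have "closed \<dots>" by (intro closed_INT ballI closed_Collect_eq continuous_intros)
  finally show ?thesis .
qed

text \<open>The common source of characters that are assembled from finite pieces. Finitely many
  index sets are dominated by their union, so antimonotonicity gives the finite intersection
  property inside a compact space.\<close>

lemma directed_compactness:
  fixes C :: "'a set \<Rightarrow> ('c \<Rightarrow> complex) set"
  assumes closed: "\<And>Q. closed (C Q)"
    and nonempty: "\<And>Q. finite Q \<Longrightarrow> Q \<subseteq> D \<Longrightarrow> \<exists>f\<in>C Q. \<forall>x. norm (f x) = 1"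
    and antimono: "\<And>Q Q'. Q \<subseteq> Q' \<Longrightarrow> C Q' \<subseteq> C Q"
  shows "\<exists>f. \<forall>Q. finite Q \<longrightarrow> Q \<subseteq> D \<longrightarrow> f \<in> C Q"
proof -
  let ?\<Q> = "{Q. finite Q \<and> Q \<subseteq> D}"
  have "{f. \<forall>x. norm (f x) = 1} \<inter> \<Inter>(C ` ?\<Q>) \<noteq> {}"
  proof (rule compact_imp_fip[OF compact_unitary_functions])
    fix \<F> assume "finite \<F>" "\<F> \<subseteq> C ` ?\<Q>"
    then obtain \<R> where R: "finite \<R>" "\<R> \<subseteq> ?\<Q>" "\<F> = C ` \<R>" by (meson finite_subset_image)
    then obtain f where "f \<in> C (\<Union>\<R>)" "\<forall>x. norm (f x) = 1"
      using nonempty[of "\<Union>\<R>"] by auto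
    moreover have "C (\<Union>\<R>) \<subseteq> \<Inter>\<F>" unfolding R(3) using antimono by blast
    ultimately show "{f. \<forall>x. norm (f x) = 1} \<inter> \<Inter>\<F> \<noteq> {}" by blast
  qed (use closed in auto)
  then show ?thesis by blast
qed

section \<open>Extension of characters from subgroups\<close>

context comm_group
begin

lemma partial_characters_one:
  assumes "subgroup H G" "f \<in> partial_characters G H"
  shows "f \<one> = 1"
proof -
  have "f (\<one> \<otimes> \<one>) = f \<one> * f \<one>"
    using assms by (intro partial_characters_mult) (auto simp: subgroup.one_closed)
  then show ?thesis using partial_characters_nonzero[OF assms(2), of \<one>] by simp
qed

lemma partial_characters_inv:
  assumes "subgroup H G" "f \<in> partial_characters G H" "x \<in> H"
  shows "f (inv x) = inverse (f x)"
proof -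
  have "x \<in> carrier G" "inv x \<in> H"
    using assms subgroup.mem_carrier subgroup.m_inv_closed by metis+
  then have "f x * f (inv x) = 1"
    using partial_characters_mult[OF assms(2,3), of "inv x"] partial_characters_one[OF assms(1,2)] by simp
  then show ?thesis by (metis inverse_unique)
qed

lemma partial_characters_nat_pow:
  assumes "subgroup H G" "f \<in> partial_characters G H" "x \<in> H"
  shows "f (x [^] (n::nat)) = f x ^ n"
proof (induction n)
  case 0
  then show ?case using partial_characters_one[OF assms(1,2)] by simp
next
  case (Suc n)
  have "x [^] n \<in> H" using subgroup_int_pow_closed[OF assms(1,3), of "int n"] by (simp add: int_pow_int)
  then show ?case using partial_characters_mult[OF assms(2) _ assms(3)] Suc by (simp add: mult.commute)
qed

lemma partial_characters_int_pow:
  assumes "subgroup H G" "f \<in> partial_characters G H" "x \<in> H"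
  shows "f (x [^] (k::int)) = f x powi k"
proof (cases "k \<ge> 0")
  case True
  then show ?thesis using partial_characters_nat_pow[OF assms]
    by (metis int_pow_int nonneg_int_cases power_int_of_nat)
next
  case False
  define n where "n = nat (- k)"
  have k: "k = - int n" using False by (simp add: n_def)
  have x: "x \<in> carrier G" using assms subgroup.mem_carrier by metis
  have xn: "x [^] n \<in> H" using subgroup_int_pow_closed[OF assms(1,3), of "int n"] by (simp add: int_pow_int)
  have "f (x [^] k) = f (inv (x [^] n))" using x by (simp add: k int_pow_neg int_pow_int)
  then show ?thesis
    using partial_characters_inv[OF assms(1,2) xn] partial_characters_nat_pow[OF assms]
    by (simp add: k power_int_minus)
qed

lemma generate_subgroup_eq:
  assumes "subgroup H G"
  shows "generate G H = H"
  using assms generate_subgroup_incl[of H H] by (auto intro: generate.incl)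

text \<open>The only constraints on the value at \<open>a\<close> come from the powers of
  \<open>a\<close> that already lie in \<open>H\<close>; a value \<open>z\<close> compatible with
  these gives a well-defined extension.\<close>

lemma partial_character_adjoin:
  assumes H: "subgroup H G" and f: "f \<in> partial_characters G H" and a: "a \<in> carrier G"
    and z: "norm z = 1" and compat: "\<And>k::int. a [^] k \<in> H \<Longrightarrow> f (a [^] k) = z powi k"
  obtains g where "g \<in> partial_characters G (generate G (insert a H))"
    "\<And>x. x \<in> H \<Longrightarrow> g x = f x" "g a = z"
proof -
  have Hc: "H \<subseteq> carrier G" using H by (rule subgroup.subset)
  have gen: "generate G (insert a H) = {d \<otimes> a [^] k |d k. d \<in> H \<and> k \<in> (UNIV :: int set)}"
    using generate_insert[OF Hc a] generate_subgroup_eq[OF H] by simp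
  have z0: "z \<noteq> 0" using z by auto
  \<comment> \<open>A representation of \<open>x\<close> as an element of \<open>H\<close> times a
    power of \<open>a\<close> is picked arbitrarily; \<open>unique\<close> shows that the value does
    not depend on it.\<close>
  define P where "P x c \<longleftrightarrow> fst c \<in> H \<and> x = fst c \<otimes> a [^] (snd c :: int)" for x c
  define g where "g x = (if x \<in> generate G (insert a H)
     then (let c = SOME c. P x c in f (fst c) * z powi (snd c)) else 1)" for x
  have unique: "f d * z powi k = f e * z powi l"
    if "d \<in> H" "e \<in> H" "d \<otimes> a [^] k = e \<otimes> a [^] l" for d e and k l :: int
  proof -
    have c: "d \<in> carrier G" "e \<in> carrier G" using that Hc by auto
    have "d \<otimes> a [^] (k - l) = (d \<otimes> a [^] k) \<otimes> inv (a [^] l)"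
      using a c by (simp add: int_pow_diff m_assoc)
    also have "\<dots> = e" using that(3) a c by (simp add: m_assoc)
    finally have e: "d \<otimes> a [^] (k - l) = e" .
    then have "a [^] (k - l) = inv d \<otimes> e" using a c by (metis inv_solve_left int_pow_closed)
    then have H': "a [^] (k - l) \<in> H"
      using that H subgroup.m_closed subgroup.m_inv_closed by metis
    have "f e = f d * z powi (k - l)"
      using partial_characters_mult[OF f that(1) H'] compat[OF H'] e by simp
    then show ?thesis using z0 by (simp add: power_int_diff)
  qed
  have g: "g (d \<otimes> a [^] k) = f d * z powi k" if "d \<in> H" for d and k :: int
  proof -
    have "P (d \<otimes> a [^] k) (d, k)" using that by (simp add: P_def)
    then have "P (d \<otimes> a [^] k) (SOME c. P (d \<otimes> a [^] k) c)" by (rule someI)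
    then have "f (fst (SOME c. P (d \<otimes> a [^] k) c)) * z powi (snd (SOME c. P (d \<otimes> a [^] k) c)) = f d * z powi k"
      using that unfolding P_def by (intro unique) auto
    moreover have "d \<otimes> a [^] k \<in> generate G (insert a H)" using gen that by auto
    ultimately show ?thesis by (simp add: g_def Let_def)
  qed
  have "g (x \<otimes> y) = g x * g y" if xy: "x \<in> generate G (insert a H)" "y \<in> generate G (insert a H)" for x y
  proof -
    obtain d k e l where *: "x = d \<otimes> a [^] (k::int)" "y = e \<otimes> a [^] (l::int)" "d \<in> H" "e \<in> H"
      using xy unfolding gen by auto
    then have "x \<otimes> y = (d \<otimes> e) \<otimes> a [^] (k + l)" using Hc a by (simp add: int_pow_mult m_ac subset_eq)
    moreover have "d \<otimes> e \<in> H" using H * by (simp add: subgroup.m_closed)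
    ultimately show ?thesis
      using * g partial_characters_mult[OF f] z0 by (simp add: power_int_add)
  qed
  moreover have "norm (g x) = 1" for x
    unfolding g_def Let_def using partial_characters_norm[OF f] z
    by (simp add: norm_mult norm_power_int)
  moreover have "g x = 1" if "x \<notin> carrier G" for x
    unfolding g_def using that generate_incl[of "insert a H"] Hc a by auto
  ultimately have "g \<in> partial_characters G (generate G (insert a H))"
    by (simp add: partial_characters_def)
  moreover have "g x = f x" if "x \<in> H" for x
    using g[OF that, of 0] that Hc by auto
  moreover have "g a = z"
    using g[of \<one> 1] subgroup.one_closed[OF H] partial_characters_one[OF H f] a by simp
  ultimately show thesis using that by blast
qed

lemma int_pow_mem_dvd:
  assumes "subgroup H G" "a \<in> carrier G" "a [^] (n::nat) \<in> H" "n > 0"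
    and least: "\<And>m. 0 < m \<Longrightarrow> m < n \<Longrightarrow> a [^] (m::nat) \<notin> H"
    and "a [^] (k::int) \<in> H"
  shows "int n dvd k"
proof -
  have "a [^] (int n * (k div int n)) \<in> H"
    using subgroup_int_pow_closed[OF assms(1,3), of "k div int n"] assms(2)
    by (simp add: int_pow_pow flip: int_pow_int)
  moreover have "k mod int n = k - int n * (k div int n)"
    by (simp add: minus_mult_div_eq_mod)
  ultimately have "a [^] (k mod int n) \<in> H"
    using assms by (simp add: int_pow_diff subgroup.m_closed subgroup.m_inv_closed)
  then have "a [^] nat (k mod int n) \<in> H" using assms(4) by (simp add: pow_nat)
  moreover have "0 \<le> k mod int n" "k mod int n < int n" using assms(4) by simp_all
  ultimately have "k mod int n = 0"
    using least[of "nat (k mod int n)"] by (cases "k mod int n = 0") (auto simp: nat_less_iff)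
  then show ?thesis by (simp add: dvd_eq_mod_eq_0)
qed

text \<open>The exponents \<open>k\<close> with \<open>a [^] k \<in> H\<close> form an ideal of the
  integers. If it is zero, the value of a character at \<open>a\<close> is unconstrained; if it is
  generated by \<open>n > 0\<close>, the value has to be an \<open>n\<close>-th root of a prescribed
  number.\<close>

lemma int_pow_mem_cases:
  assumes "subgroup H G" "a \<in> carrier G"
  obtains (infinite) "\<And>k::int. a [^] k \<in> H \<Longrightarrow> k = 0"
  | (finite) n where "n > 0" "a [^] (n::nat) \<in> H" "\<And>k::int. a [^] k \<in> H \<Longrightarrow> int n dvd k"
proof (cases "\<exists>n::nat. n > 0 \<and> a [^] n \<in> H")
  case True
  define n where "n = (LEAST n::nat. n > 0 \<and> a [^] n \<in> H)"
  have n: "n > 0" "a [^] n \<in> H" using LeastI_ex[OF True] by (simp_all add: n_def)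
  have "a [^] m \<notin> H" if "0 < m" "m < n" for m :: nat
    using that not_less_Least unfolding n_def by blast
  then show thesis using finite[OF n] int_pow_mem_dvd[OF assms n(2,1)] by blast
next
  case False
  have "k = 0" if k: "a [^] k \<in> H" for k :: int
  proof (rule ccontr)
    assume "k \<noteq> 0"
    show False
    proof (cases "k > 0")
      case True
      then show False using False k by (metis int_pow_int pos_int_cases)
    next
      case neg: False
      have "a [^] (- k) \<in> H" using k assms by (simp add: int_pow_neg subgroup.m_inv_closed)
      moreover have "- k > 0" using neg \<open>k \<noteq> 0\<close> by simp
      ultimately show False using False by (metis int_pow_int pos_int_cases)
    qed
  qed
  then show thesis using infinite by blast
qed

lemma partial_character_extend_finite:
  assumes H: "subgroup H G" and f: "f \<in> partial_characters G H"
    and "finite Q" "Q \<subseteq> carrier G"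
  shows "\<exists>g\<in>partial_characters G (generate G (H \<union> Q)). \<forall>x\<in>H. g x = f x"
  using assms(3,4)
proof (induction Q rule: finite_induct)
  case empty
  then show ?case using f generate_subgroup_eq[OF H] by auto
next
  case (insert a Q)
  then obtain g where g: "g \<in> partial_characters G (generate G (H \<union> Q))" "\<forall>x\<in>H. g x = f x" by auto
  have a: "a \<in> carrier G" using insert by auto
  have c: "H \<union> Q \<subseteq> carrier G" using insert subgroup.subset[OF H] by auto
  let ?K = "generate G (H \<union> Q)"
  have K: "subgroup ?K G" by (rule generate_is_subgroup[OF c])
  obtain z where z: "norm z = 1" "\<And>k::int. a [^] k \<in> ?K \<Longrightarrow> g (a [^] k) = z powi k"
    using K a
  proof (cases rule: int_pow_mem_cases)
    case infinite
    show thesis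
    proof (rule that[of 1])
      fix k :: int assume "a [^] k \<in> ?K"
      then have "k = 0" by (rule infinite)
      then show "g (a [^] k) = 1 powi k" using partial_characters_one[OF K g(1)] by simp
    qed auto
  next
    case (finite n)
    define \<theta> where "\<theta> = Arg (g (a [^] n))"
    have \<theta>: "cis \<theta> = g (a [^] n)"
      using partial_characters_norm[OF g(1)] partial_characters_nonzero[OF g(1)]
      by (simp add: \<theta>_def cis_Arg sgn_div_norm)
    show thesis
    \<comment> \<open>Dividing the angle gives an \<open>n\<close>-th root of the prescribed value
      at \<open>a [^] n\<close>: this is the divisibility of the circle.\<close>
    proof (rule that[of "cis (\<theta> / n)"])
      fix k :: int assume "a [^] k \<in> ?K"
      then obtain j where j: "k = int n * j" using finite by auto
      then have "a [^] k = (a [^] n) [^] j" using a by (simp add: int_pow_pow flip: int_pow_int)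
      then have "g (a [^] k) = cis \<theta> powi j"
        using partial_characters_int_pow[OF K g(1) finite(2)] \<theta> by simp
      then show "g (a [^] k) = cis (\<theta> / n) powi k"
        using \<open>n > 0\<close> by (simp add: j cis_power_int field_simps)
    qed auto
  qed
  obtain h where h: "h \<in> partial_characters G (generate G (insert a ?K))"
    "\<And>x. x \<in> ?K \<Longrightarrow> h x = g x"
    using partial_character_adjoin[OF K g(1) a z] by blast
  have "generate G (H \<union> insert a Q) \<subseteq> generate G (insert a ?K)"
    using generate_incl[OF c] a
    by (intro generate_subgroup_incl generate_is_subgroup) (auto intro: generate.incl)
  then have "h \<in> partial_characters G (generate G (H \<union> insert a Q))"
    using h(1) partial_characters_antimono by blast
  moreover have "h x = f x" if "x \<in> H" for x
    using h(2) g(2) that by (simp add: generate.incl)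
  ultimately show ?case by blast
qed

lemma character_extension:
  assumes H: "subgroup H G" and f: "f \<in> partial_characters G H"
  obtains \<phi> where "\<phi> \<in> characters G" "\<And>x. x \<in> H \<Longrightarrow> \<phi> x = f x"
proof -
  have "\<exists>\<phi>. \<forall>Q. finite Q \<longrightarrow> Q \<subseteq> carrier G \<longrightarrow>
      \<phi> \<in> partial_characters G (generate G (H \<union> Q)) \<inter> {g. \<forall>x\<in>H. g x = f x}"
  proof (rule directed_compactness)
    show "closed (partial_characters G (generate G (H \<union> Q)) \<inter> {g. \<forall>x\<in>H. g x = f x})" for Q
      by (intro closed_Int closed_partial_characters closed_agreeing_functions)
    fix Q Q' :: "'a set" assume "Q \<subseteq> Q'"
    then have "generate G (H \<union> Q) \<subseteq> generate G (H \<union> Q')" by (intro mono_generate) auto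
    then show "partial_characters G (generate G (H \<union> Q')) \<inter> {g. \<forall>x\<in>H. g x = f x}
       \<subseteq> partial_characters G (generate G (H \<union> Q)) \<inter> {g. \<forall>x\<in>H. g x = f x}"
      using partial_characters_antimono by blast
  next
    fix Q assume "finite Q" "Q \<subseteq> carrier G"
    from partial_character_extend_finite[OF H f this]
    obtain g where g: "g \<in> partial_characters G (generate G (H \<union> Q))" "\<forall>x\<in>H. g x = f x" ..
    then show "\<exists>g\<in>partial_characters G (generate G (H \<union> Q)) \<inter> {g. \<forall>x\<in>H. g x = f x}. \<forall>x. norm (g x) = 1"
      using partial_characters_norm[OF g(1)] by (intro bexI[of _ g]) auto
  qed
  then obtain \<phi> where \<phi>: "\<And>Q. finite Q \<Longrightarrow> Q \<subseteq> carrier G \<Longrightarrow>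
      \<phi> \<in> partial_characters G (generate G (H \<union> Q)) \<inter> {g. \<forall>x\<in>H. g x = f x}" by blast
  \<comment> \<open>Each instance of multiplicativity involves two elements, so it can be read off
    at the finite set \<open>{x, y}\<close>.\<close>
  have "\<phi> (x \<otimes> y) = \<phi> x * \<phi> y" if "x \<in> carrier G" "y \<in> carrier G" for x y
  proof (rule partial_characters_mult)
    show "\<phi> \<in> partial_characters G (generate G (H \<union> {x, y}))" using \<phi>[of "{x, y}"] that by auto
  qed (auto intro: generate.incl)
  then have "\<phi> \<in> characters G"
    using \<phi>[of "{}"] by (simp add: partial_characters_def)
  moreover have "\<phi> x = f x" if "x \<in> H" for x using \<phi>[of "{}"] that by simp
  ultimately show thesis using that by blast
qed

text \<open>The trivial character of \<open>H\<close> is extended with a value other than 1 at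
  \<open>a\<close>.\<close>

lemma character_separation:
  assumes H: "subgroup H G" and a: "a \<in> carrier G" "a \<notin> H"
  obtains \<phi> where "\<phi> \<in> characters G" "\<And>x. x \<in> H \<Longrightarrow> \<phi> x = 1" "\<phi> a \<noteq> 1"
proof -
  obtain z :: complex where z: "norm z = 1" "\<And>k::int. a [^] k \<in> H \<Longrightarrow> 1 = z powi k" "z \<noteq> 1"
    using H a(1)
  proof (cases rule: int_pow_mem_cases)
    case infinite
    then show thesis using that[of "-1"] by force
  next
    case (finite n)
    have "n \<noteq> 1" using finite a by auto
    then have n: "n \<ge> 2" using finite by simp
    show thesis
    \<comment> \<open>A primitive \<open>n\<close>-th root of unity; it differs from 1 because
      \<open>a \<notin> H\<close> forces \<open>n\<close> to be at least 2.\<close>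
    proof (rule that[of "cis (2 * pi / n)"])
      fix k :: int assume "a [^] k \<in> H"
      then obtain j where "k = int n * j" using finite by auto
      then show "1 = cis (2 * pi / n) powi k"
        using n cis_multiple_2pi[of "of_int j"] by (simp add: cis_power_int mult_ac)
    next
      have "0 < pi / n" "pi / n < pi" using n by (simp_all add: field_simps)
      then have "sin (pi / n) \<noteq> 0" using sin_gt_zero by fastforce
      moreover have "cos (2 * (pi / n)) = 1 - 2 * (sin (pi / n))\<^sup>2" by (rule cos_double_sin)
      ultimately have "cos (2 * pi / n) \<noteq> 1" by simp
      then show "cis (2 * pi / n) \<noteq> 1" by (auto simp: complex_eq_iff)
    qed auto
  qed
  obtain g where g: "g \<in> partial_characters G (generate G (insert a H))" "\<And>x. x \<in> H \<Longrightarrow> g x = 1" "g a = z"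
    using partial_character_adjoin[OF H trivial_partial_character a(1) z(1,2)] by blast
  have "subgroup (generate G (insert a H)) G"
    using a subgroup.subset[OF H] by (intro generate_is_subgroup) auto
  then obtain \<phi> where \<phi>: "\<phi> \<in> characters G" "\<And>x. x \<in> generate G (insert a H) \<Longrightarrow> \<phi> x = g x"
    using character_extension[OF _ g(1)] by blast
  have "\<phi> x = g x" if "x \<in> insert a H" for x using \<phi>(2) that by (simp add: generate.incl)
  then show thesis using that[OF \<phi>(1)] g(2,3) z(3) by simp
qed

end

section \<open>The number of characters\<close>

lemma Pow_lepoll_mono:
  assumes "A \<lesssim> B"
  shows "Pow A \<lesssim> Pow B"
proof -
  obtain f where "inj_on f A" "f ` A \<subseteq> B" using assms by (auto simp: lepoll_def)
  then have "inj_on (image f) (Pow A)" "image f ` Pow A \<subseteq> Pow B"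
    by (auto simp: inj_on_image_Pow)
  then show ?thesis unfolding lepoll_def by blast
qed

text \<open>Characters glue along a well-order: at each step \<open>a\<close> outside the subgroup generated by
  the predecessors there are two distinct extensions to choose from, and compactness takes care of
  the limit steps.\<close>

lemma (in comm_group) Pow_strict_steps_lepoll_characters:
  assumes wf: "wf r" and trans: "trans r" and total: "total r"
    and J: "J \<subseteq> {a \<in> carrier G. a \<notin> generate G {b \<in> carrier G. (b, a) \<in> r}}"
  shows "Pow J \<lesssim> characters G"
proof -
  let ?below = "\<lambda>a. {b \<in> carrier G. (b, a) \<in> r}"
  define ext where "ext f a = {\<phi> \<in> characters G. \<forall>b\<in>?below a. \<phi> b = f b}" for f a
  \<comment> \<open>\<open>c0\<close> picks an extension of the values below \<open>a\<close>, and
    \<open>c1\<close> one that disagrees with it at \<open>a\<close>. Membership of \<open>a\<close>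
    in \<open>E\<close> decides which of them supplies the value, so that \<open>E\<close> can be
    read off on \<open>J\<close>.\<close>
  define c0 where "c0 f a = (SOME \<phi>. \<phi> \<in> ext f a)" for f a
  define c1 where "c1 f a = (SOME \<phi>. \<phi> \<in> ext f a \<and> \<phi> a \<noteq> c0 f a a)" for f a
  define F where "F E = wfrec r (\<lambda>f a. if a \<in> E then c1 f a a else c0 f a a)" for E
  have ext_cong: "ext f a = ext g a" if "\<And>b. b \<in> ?below a \<Longrightarrow> f b = g b" for f g a
    using that by (auto simp: ext_def)
  have F: "F E a = (if a \<in> E then c1 (F E) a a else c0 (F E) a a)" for E a
  proof -
    \<comment> \<open>The recursion equation holds for the uncut function, since \<open>ext\<close>
      looks only at values below \<open>a\<close>.\<close>
    have "ext (cut (F E) r a) a = ext (F E) a" by (rule ext_cong) (simp add: cut_apply)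
    then have "c0 (cut (F E) r a) a = c0 (F E) a" "c1 (cut (F E) r a) a = c1 (F E) a"
      by (simp_all add: c0_def c1_def)
    moreover have "F E a = (if a \<in> E then c1 (cut (F E) r a) a a else c0 (cut (F E) r a) a a)"
      unfolding F_def by (subst wfrec[OF wf]) (rule refl)
    ultimately show ?thesis by simp
  qed
  have c0: "c0 f a \<in> ext f a" if "ext f a \<noteq> {}" for f a
    using that unfolding c0_def by (simp add: some_in_eq)
  have c1: "c1 f a \<in> ext f a \<and> c1 f a a \<noteq> c0 f a a" if ne: "ext f a \<noteq> {}" and aJ: "a \<in> J" for f a
  proof -
    have sg: "subgroup (generate G (?below a)) G" by (rule generate_is_subgroup) auto
    have a: "a \<in> carrier G" "a \<notin> generate G (?below a)" using aJ J by auto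
    obtain \<psi> where \<psi>: "\<psi> \<in> characters G" "\<And>x. x \<in> generate G (?below a) \<Longrightarrow> \<psi> x = 1" "\<psi> a \<noteq> 1"
      using character_separation[OF sg a] by blast
    \<comment> \<open>A factor that is 1 below \<open>a\<close> but not at \<open>a\<close> moves
      the value there without disturbing the earlier ones.\<close>
    let ?\<phi> = "\<lambda>x. c0 f a x * \<psi> x"
    have c0f: "c0 f a \<in> characters G" "\<forall>b\<in>?below a. c0 f a b = f b" using c0[OF ne] by (auto simp: ext_def)
    have "?\<phi> \<in> ext f a"
      using characters_times[OF c0f(1) \<psi>(1)] c0f(2) \<psi>(2) by (simp add: ext_def generate.incl)
    moreover have "?\<phi> a \<noteq> c0 f a a" using \<psi>(3) partial_characters_nonzero[OF c0f(1)] by simp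
    ultimately have "\<exists>\<phi>. \<phi> \<in> ext f a \<and> \<phi> a \<noteq> c0 f a a" by blast
    then show ?thesis unfolding c1_def by (rule someI_ex)
  qed
  \<comment> \<open>A finite subset of \<open>D\<close> has an \<open>r\<close>-largest element, and
    the character that is right up to that element fits the whole subset.\<close>
  have glue: "\<exists>\<phi>\<in>characters G. \<forall>b\<in>D. \<phi> b = f b"
    if D: "D \<subseteq> carrier G"
      and loc: "\<And>m. m \<in> D \<Longrightarrow> \<exists>\<phi>\<in>characters G. \<forall>b\<in>D. b = m \<or> (b, m) \<in> r \<longrightarrow> \<phi> b = f b" for D f
  proof -
    have "\<exists>\<phi>. \<forall>Q. finite Q \<longrightarrow> Q \<subseteq> D \<longrightarrow> \<phi> \<in> characters G \<inter> {g. \<forall>x\<in>Q. g x = f x}"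
    proof (rule directed_compactness)
      fix Q assume Q: "finite Q" "Q \<subseteq> D"
      have "\<exists>\<phi>\<in>characters G. \<forall>b\<in>Q. \<phi> b = f b"
      proof (cases "Q = {}")
        case True
        then show ?thesis using trivial_partial_character by blast
      next
        case False
        have "\<exists>m\<in>Q. \<forall>b\<in>Q. b = m \<or> (b, m) \<in> r"
          using Q(1) False
        proof (induction Q rule: finite_ne_induct)
          case (insert x Q)
          then obtain m where m: "m \<in> Q" "\<forall>b\<in>Q. b = m \<or> (b, m) \<in> r" by blast
          show ?case
          proof (cases "x = m \<or> (x, m) \<in> r")
            case True
            then show ?thesis using m by auto
          next
            case False
            then have "(m, x) \<in> r" using total by (auto simp: total_on_def)
            then show ?thesis using m(2) transD[OF trans] by (intro bexI[of _ x]) auto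
          qed
        qed auto
        then obtain m where m: "m \<in> Q" "\<forall>b\<in>Q. b = m \<or> (b, m) \<in> r" ..
        then obtain \<phi> where "\<phi> \<in> characters G" "\<forall>b\<in>D. b = m \<or> (b, m) \<in> r \<longrightarrow> \<phi> b = f b"
          using loc[of m] Q(2) by blast
        then show ?thesis using m(2) Q(2) by blast
      qed
      then obtain \<phi> where "\<phi> \<in> characters G" "\<forall>b\<in>Q. \<phi> b = f b" ..
      then show "\<exists>\<phi>\<in>characters G \<inter> {g. \<forall>x\<in>Q. g x = f x}. \<forall>x. norm (\<phi> x) = 1"
        using partial_characters_norm[of \<phi>] by (intro bexI[of _ \<phi>]) auto
    qed (auto intro!: closed_Int closed_partial_characters closed_agreeing_functions)
    then obtain \<phi> where \<phi>: "\<And>Q. finite Q \<Longrightarrow> Q \<subseteq> D \<Longrightarrow> \<phi> \<in> characters G \<inter> {g. \<forall>x\<in>Q. g x = f x}" by blast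
    have "\<phi> b = f b" if "b \<in> D" for b using \<phi>[of "{b}"] that by auto
    then show ?thesis using \<phi>[of "{}"] by auto
  qed
  have loc: "\<exists>\<phi>\<in>characters G. \<forall>b\<in>carrier G. b = a \<or> (b, a) \<in> r \<longrightarrow> \<phi> b = F E b"
    and ne: "ext (F E) a \<noteq> {}" if "E \<subseteq> J" "a \<in> carrier G" for E a
  proof -
    \<comment> \<open>Both facts go through one induction: the extension needed at \<open>a\<close>
      is glued from the characters found at the predecessors.\<close>
    have "ext (F E) a \<noteq> {} \<and> (\<exists>\<phi>\<in>characters G. \<forall>b\<in>carrier G. b = a \<or> (b, a) \<in> r \<longrightarrow> \<phi> b = F E b)"
      using wf that(2)
    proof (induction a rule: wf_induct_rule)
      case (less a)
      have "\<exists>\<phi>\<in>characters G. \<forall>b\<in>?below a. \<phi> b = F E b"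
      proof (rule glue)
        fix m assume "m \<in> ?below a"
        then show "\<exists>\<phi>\<in>characters G. \<forall>b\<in>?below a. b = m \<or> (b, m) \<in> r \<longrightarrow> \<phi> b = F E b"
          using less.IH[of m] by blast
      qed auto
      then have ne: "ext (F E) a \<noteq> {}" by (auto simp: ext_def)
      define \<phi> where "\<phi> = (if a \<in> E then c1 (F E) a else c0 (F E) a)"
      have "\<phi> \<in> ext (F E) a" using c0[OF ne] c1[OF ne] that(1) by (auto simp: \<phi>_def)
      moreover have "\<phi> a = F E a" using F[of E a] by (simp add: \<phi>_def)
      ultimately show ?case using ne by (auto simp: ext_def)
    qed
    then show "\<exists>\<phi>\<in>characters G. \<forall>b\<in>carrier G. b = a \<or> (b, a) \<in> r \<longrightarrow> \<phi> b = F E b"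
      and "ext (F E) a \<noteq> {}" by blast+
  qed
  have "\<exists>\<phi>\<in>characters G. \<forall>b\<in>carrier G. \<phi> b = F E b" if "E \<subseteq> J" for E
    by (rule glue) (use loc[OF that] in auto)
  then obtain X where X: "\<And>E. E \<subseteq> J \<Longrightarrow> X E \<in> characters G"
    "\<And>E b. E \<subseteq> J \<Longrightarrow> b \<in> carrier G \<Longrightarrow> X E b = F E b" by metis
  have sub: "E \<subseteq> E'" if E: "E \<subseteq> J" "E' \<subseteq> J" "X E = X E'" for E E'
  proof (rule subsetI, rule ccontr)
    fix a assume a: "a \<in> E" "a \<notin> E'"
    have ac: "a \<in> carrier G" using a E J by auto
    have eq: "F E b = F E' b" if "b \<in> carrier G" for b using X(2)[OF E(1) that] X(2)[OF E(2) that] E(3) by simp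
    \<comment> \<open>The two recursions agree on the group and so share the default extension
      \<open>c0\<close> at \<open>a\<close>; \<open>F E'\<close> takes its value there, whereas
      \<open>F E\<close> avoids it.\<close>
    have "ext (F E) a = ext (F E') a" by (rule ext_cong) (simp add: eq)
    then have "c0 (F E) a = c0 (F E') a" by (simp add: c0_def)
    then have "F E' a = c0 (F E) a a" using F[of E' a] a by simp
    moreover have "F E a \<noteq> c0 (F E) a a" using F[of E a] a c1[OF ne[OF E(1) ac]] E by auto
    ultimately show False using eq[OF ac] by simp
  qed
  have "inj_on X (Pow J)"
    by (intro inj_onI subset_antisym) (auto dest: sub[OF _ _ sym] sub)
  then show ?thesis using X(1) by (auto simp: lepoll_def)
qed

text \<open>Serves the case of finitely many strict steps: if finitely many elements generate an
  infinite group, one of them has infinite order.\<close>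

lemma (in comm_group) finite_generate_torsion:
  assumes "finite B" "B \<subseteq> carrier G" "\<And>b. b \<in> B \<Longrightarrow> \<exists>n>0. b [^] (n::nat) = \<one>"
  shows "finite (generate G B)"
  using assms
proof (induction B rule: finite_induct)
  case empty
  have "generate G {} = {\<one>}"
    using generate_subgroup_incl[of "{}" "{\<one>}"] triv_subgroup generate.one[of G "{}"] by auto
  then show ?case by simp
next
  case (insert y B)
  then have fin: "finite (generate G B)" and y: "y \<in> carrier G" by auto
  obtain n where n: "n > 0" "y [^] (n::nat) = \<one>" using insert.prems by blast
  have "y [^] k \<in> (\<lambda>i. y [^] (i::int)) ` {0..<int n}" for k :: int
  proof -
    have "y [^] (int n * (k div int n)) = \<one>" using n y by (simp add: int_pow_int flip: int_pow_pow)
    then have "y [^] k = y [^] (k mod int n)"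
      using int_pow_mult[OF y, of "int n * (k div int n)" "k mod int n"] y by simp
    then show ?thesis using n by auto
  qed
  then have "generate G (insert y B) \<subseteq> (\<lambda>(d, e). d \<otimes> e) ` (generate G B \<times> (\<lambda>i. y [^] (i::int)) ` {0..<int n})"
    using generate_insert[of B y] insert.prems y by fastforce
  moreover have "finite \<dots>" using fin by simp
  ultimately show ?case by (rule finite_subset)
qed

lemma (in comm_group) infinite_order_characters:
  assumes g: "g \<in> carrier G" "\<And>n::nat. n > 0 \<Longrightarrow> g [^] n \<noteq> \<one>"
  shows "(UNIV :: nat set set) \<lesssim> characters G"
proof -
  have triv: "subgroup {\<one>} G" by (rule triv_subgroup)
  have "\<exists>\<phi>\<in>characters G. \<phi> g = z" if z: "norm z = 1" for z :: complex
  proof -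
    \<comment> \<open>Infinite order leaves no relation over the trivial subgroup, so every
      unimodular \<open>z\<close> is compatible.\<close>
    have "(\<lambda>_. 1) (g [^] k) = z powi k" if "g [^] k \<in> {\<one>}" for k :: int
    proof -
      have "k = 0" using triv g(1)
      proof (cases rule: int_pow_mem_cases)
        case (finite n)
        then show ?thesis using g(2) by auto
      qed (use that in auto)
      then show ?thesis by simp
    qed
    then obtain f where f: "f \<in> partial_characters G (generate G (insert g {\<one>}))" "f g = z"
      using partial_character_adjoin[OF triv trivial_partial_character g(1) z] by metis
    have "subgroup (generate G (insert g {\<one>})) G" using g by (intro generate_is_subgroup) auto
    then obtain \<phi> where "\<phi> \<in> characters G" "\<And>x. x \<in> generate G (insert g {\<one>}) \<Longrightarrow> \<phi> x = f x"
      using character_extension[OF _ f(1)] by blast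
    then show ?thesis using f(2) by (intro bexI[of _ \<phi>]) (auto intro: generate.incl)
  qed
  then obtain X where X: "\<And>z. norm z = 1 \<Longrightarrow> X z \<in> characters G" "\<And>z. norm z = 1 \<Longrightarrow> X z g = z" by metis
  \<comment> \<open>On this arc \<open>cis\<close> is injective because \<open>cos\<close> is
    injective on the interval from 0 to \<open>pi\<close>; the arc already has the cardinality of
    the continuum.\<close>
  have "inj_on (\<lambda>t. X (cis t)) {0..<1::real}"
  proof (rule inj_onI)
    fix s t :: real assume st: "s \<in> {0..<1}" "t \<in> {0..<1}" "X (cis s) = X (cis t)"
    then have "cis s = cis t" by (metis X(2) norm_cis)
    then have "cos s = cos t" by (metis cis.simps(1))
    moreover have "s \<le> pi" "t \<le> pi" "0 \<le> s" "0 \<le> t" using st pi_gt3 by auto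
    ultimately show "s = t" using cos_inj_pi by blast
  qed
  moreover have "(\<lambda>t. X (cis t)) ` {0..<1::real} \<subseteq> characters G" using X(1) by auto
  ultimately have "{0..<1::real} \<lesssim> characters G" unfolding lepoll_def by blast
  then show ?thesis by (rule lepoll_trans[OF nat_sets_lepoll_reals01])
qed

text \<open>By well-founded induction, the elements not generated by their predecessors generate
  everything. Infinitely many such elements are as numerous as the group; if there are finitely
  many, the group is countable and one of them has infinite order, so a continuum of characters is
  enough.\<close>

lemma (in comm_group) Pow_carrier_lepoll_characters:
  assumes inf: "infinite (carrier G)"
  shows "Pow (carrier G) \<lesssim> characters G"
proof -
  obtain r :: "'a rel" where r: "well_order_on UNIV r" using well_order_on by blast
  define s where "s = r - Id"
  have s: "wf s" "trans s" "total s"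
    using r unfolding s_def well_order_on_def linear_order_on_def partial_order_on_def preorder_on_def
    by (auto intro: trans_diff_Id)
  define J where "J = {a \<in> carrier G. a \<notin> generate G {b \<in> carrier G. (b, a) \<in> s}}"
  have Pow: "Pow J \<lesssim> characters G"
    using Pow_strict_steps_lepoll_characters[OF s, of J] by (simp add: J_def)
  have J: "J \<subseteq> carrier G" by (auto simp: J_def)
  have "a \<in> generate G J" if "a \<in> carrier G" for a
    using s(1) that
  proof (induction a rule: wf_induct_rule)
    case (less a)
    show ?case
    proof (cases "a \<in> J")
      case True
      then show ?thesis by (rule generate.incl)
    next
      case False
      have "generate G {b \<in> carrier G. (b, a) \<in> s} \<subseteq> generate G J"
        using less.IH by (intro generate_subgroup_incl generate_is_subgroup[OF J]) auto
      then show ?thesis using False less.prems by (auto simp: J_def)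
    qed
  qed
  then have gen: "carrier G \<subseteq> generate G J" by blast
  show ?thesis
  proof (cases "finite J")
    case False
    have "carrier G \<lesssim> J"
      using subset_imp_lepoll[OF gen] generate_lepoll[OF False J lepoll_refl] by (rule lepoll_trans)
    then show ?thesis using Pow Pow_lepoll_mono lepoll_trans by blast
  next
    case True
    have "\<exists>g\<in>J. \<forall>n::nat. n > 0 \<longrightarrow> g [^] n \<noteq> \<one>"
    proof (rule ccontr)
      assume "\<not> ?thesis"
      then have "finite (generate G J)" by (intro finite_generate_torsion True J) auto
      then show False using gen inf finite_subset by blast
    qed
    then have 1: "(UNIV :: nat set set) \<lesssim> characters G"
      using infinite_order_characters J by blast
    have "generate G J \<lesssim> (UNIV :: nat set)"
      using True by (intro generate_lepoll J finite_lepoll_infinite) auto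
    then have "carrier G \<lesssim> (UNIV :: nat set)" by (rule lepoll_trans[OF subset_imp_lepoll[OF gen]])
    then have "Pow (carrier G) \<lesssim> (UNIV :: nat set set)" using Pow_lepoll_mono by fastforce
    then show ?thesis using 1 by (rule lepoll_trans)
  qed
qed

section \<open>The theorem of Comfort and Ross\<close>

lemma (in comm_group) nontrivial_character_mean:
  fixes \<eta> :: real
  assumes \<phi>: "\<phi> \<in> characters G" "\<phi> \<noteq> (\<lambda>_. 1)" and \<eta>: "\<eta> > 0"
  shows "\<exists>ys. ys \<noteq> [] \<and> set ys \<subseteq> carrier G \<and> norm (\<Sum>y\<leftarrow>ys. \<phi> y) \<le> \<eta> * length ys"
proof -
  obtain g where g': "\<phi> g \<noteq> 1" using \<phi>(2) by auto
  then have g: "g \<in> carrier G" using \<phi>(1) by (auto simp: partial_characters_def)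
  define w where "w = \<phi> g"
  have w: "w \<noteq> 1" "norm w = 1" using g' partial_characters_norm[OF \<phi>(1)] by (simp_all add: w_def)
  \<comment> \<open>Geometric sums of \<open>w\<close> stay below \<open>2 / norm (1 - w)\<close>,
    so this many powers of \<open>g\<close> bring the average down to \<eta>.\<close>
  define L where "L = Suc (nat \<lceil>2 / (norm (1 - w) * \<eta>)\<rceil>)"
  define ys where "ys = map (\<lambda>k. g [^] (k::nat)) [0..<L]"
  have "(\<Sum>y\<leftarrow>ys. \<phi> y) = (\<Sum>k<L. w ^ k)"
    using partial_characters_nat_pow[OF subgroup_self \<phi>(1) g]
    by (simp add: ys_def w_def comp_def interv_sum_list_conv_sum_set_nat lessThan_atLeast0 cong: sum.cong)
  also have "\<dots> = (1 - w ^ L) / (1 - w)" using w(1) by (simp add: sum_gp_strict)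
  also have "norm \<dots> \<le> 2 / norm (1 - w)"
    using norm_triangle_ineq4[of 1 "w ^ L"] w by (simp add: norm_divide norm_power divide_right_mono)
  also have "\<dots> \<le> \<eta> * L"
  proof -
    have "2 / (norm (1 - w) * \<eta>) \<le> L" unfolding L_def by linarith
    then show ?thesis using w \<eta> by (simp add: field_simps)
  qed
  finally have "norm (\<Sum>y\<leftarrow>ys. \<phi> y) \<le> \<eta> * length ys" by (simp add: ys_def)
  moreover have "ys \<noteq> []" "set ys \<subseteq> carrier G" using g by (auto simp: ys_def L_def)
  ultimately show ?thesis by blast
qed

lemma norm_sum_list_characters:
  assumes "\<phi> \<in> characters G"
  shows "norm (\<Sum>y\<leftarrow>ys. \<phi> y) \<le> length ys"
proof (induction ys)
  case (Cons y ys)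
  then show ?case
    using norm_triangle_ineq[of "\<phi> y" "\<Sum>y\<leftarrow>ys. \<phi> y"] partial_characters_norm[OF assms, of y] by simp
qed simp

text \<open>Lists rather than sets record the sample points, because products may coincide and have
  to be counted with multiplicity.\<close>

lemma sum_list_characters_product:
  assumes "\<phi> \<in> characters G" "set xs \<subseteq> carrier G" "set ys \<subseteq> carrier G"
  shows "(\<Sum>z\<leftarrow>concat (map (\<lambda>x. map (\<lambda>y. x \<otimes>\<^bsub>G\<^esub> y) ys) xs). \<phi> z) = (\<Sum>x\<leftarrow>xs. \<phi> x) * (\<Sum>y\<leftarrow>ys. \<phi> y)"
  using assms(2)
proof (induction xs)
  case (Cons x xs)
  have "(\<Sum>y\<leftarrow>ys. \<phi> (x \<otimes>\<^bsub>G\<^esub> y)) = (\<Sum>y\<leftarrow>ys. \<phi> x * \<phi> y)"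
    using Cons.prems assms partial_characters_mult[OF assms(1)]
    by (intro arg_cong[where f = sum_list] map_cong) auto
  then show ?case using Cons by (simp add: comp_def sum_list_const_mult distrib_right)
qed simp

text \<open>Multiplying lists elementwise multiplies the averages, so lists adapted to single characters
  combine to one that is good for finitely many.\<close>

lemma (in comm_group) characters_mean_list:
  fixes \<eta> :: real
  assumes "finite \<Phi>" "\<Phi> \<subseteq> characters G - {\<lambda>_. 1}" "\<eta> > 0"
  shows "\<exists>xs. xs \<noteq> [] \<and> set xs \<subseteq> carrier G \<and> (\<forall>\<phi>\<in>\<Phi>. norm (\<Sum>x\<leftarrow>xs. \<phi> x) \<le> \<eta> * length xs)"
  using assms(1,2)
proof (induction \<Phi> rule: finite_induct)
  case empty
  show ?case by (intro exI[of _ "[\<one>]"]) auto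
next
  case (insert \<phi> \<Phi>)
  then obtain xs where xs: "xs \<noteq> []" "set xs \<subseteq> carrier G"
    "\<And>\<psi>. \<psi> \<in> \<Phi> \<Longrightarrow> norm (\<Sum>x\<leftarrow>xs. \<psi> x) \<le> \<eta> * length xs" by blast
  obtain ys where ys: "ys \<noteq> []" "set ys \<subseteq> carrier G" "norm (\<Sum>y\<leftarrow>ys. \<phi> y) \<le> \<eta> * length ys"
    using nontrivial_character_mean[of \<phi> \<eta>] insert.prems assms(3) by blast
  define zs where "zs = concat (map (\<lambda>x. map (\<lambda>y. x \<otimes> y) ys) xs)"
  have len: "length zs = length xs * length ys"
    by (simp add: zs_def length_concat comp_def sum_list_triv)
  have "norm (\<Sum>z\<leftarrow>zs. \<psi> z) \<le> \<eta> * length zs" if \<psi>: "\<psi> \<in> insert \<phi> \<Phi>" for \<psi>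
  proof -
    have c: "\<psi> \<in> characters G" using insert.prems \<psi> by auto
    have eq: "norm (\<Sum>z\<leftarrow>zs. \<psi> z) = norm (\<Sum>x\<leftarrow>xs. \<psi> x) * norm (\<Sum>y\<leftarrow>ys. \<psi> y)"
      unfolding zs_def sum_list_characters_product[OF c xs(2) ys(2)] by (rule norm_mult)
    show ?thesis
    proof (cases "\<psi> = \<phi>")
      case True
      have "norm (\<Sum>x\<leftarrow>xs. \<psi> x) * norm (\<Sum>y\<leftarrow>ys. \<psi> y) \<le> length xs * (\<eta> * length ys)"
        using norm_sum_list_characters[OF c, of xs] ys(3) True by (intro mult_mono) auto
      then show ?thesis by (simp add: eq len mult_ac)
    next
      case False
      then have "norm (\<Sum>x\<leftarrow>xs. \<psi> x) * norm (\<Sum>y\<leftarrow>ys. \<psi> y) \<le> (\<eta> * length xs) * length ys"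
        using norm_sum_list_characters[OF c, of ys] xs(3)[of \<psi>] \<psi> assms(3) by (intro mult_mono) auto
      then show ?thesis by (simp add: eq len mult_ac)
    qed
  qed
  moreover have "zs \<noteq> []" using xs(1) ys(1) len by (metis length_0_conv mult_is_0)
  moreover have "set zs \<subseteq> carrier G" using xs(2) ys(2) by (auto simp: zs_def)
  ultimately show ?case by blast
qed

lemma (in comm_group) characters_mean:
  fixes \<eta> :: real
  assumes "finite \<Phi>" "\<Phi> \<subseteq> characters G - {\<lambda>_. 1}" "\<eta> > 0"
  obtains L :: nat and g where "L > 0" "\<And>i. i < L \<Longrightarrow> g i \<in> carrier G"
    "\<And>\<phi>. \<phi> \<in> \<Phi> \<Longrightarrow> norm (\<Sum>i<L. \<phi> (g i)) \<le> \<eta> * L"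
proof -
  obtain xs where xs: "xs \<noteq> []" "set xs \<subseteq> carrier G"
    "\<And>\<phi>. \<phi> \<in> \<Phi> \<Longrightarrow> norm (\<Sum>x\<leftarrow>xs. \<phi> x) \<le> \<eta> * length xs"
    using characters_mean_list[OF assms] by blast
  show thesis
    by (rule that[of "length xs" "\<lambda>i. xs ! i"])
      (use xs nth_mem in \<open>auto simp: sum_list_sum_nth lessThan_atLeast0\<close>)
qed

text \<open>These are the positive-definite trigonometric polynomials with spectrum in
  \<open>V\<close>. Setting \<open>c\<close> to 0 outside \<open>V\<close> lets the coefficients be
  carried along a translation of the spectrum into a larger set.\<close>

definition nonneg_combination :: "('a, 'b) monoid_scheme \<Rightarrow> ('a \<Rightarrow> complex) set \<Rightarrow> ('a \<Rightarrow> complex) \<Rightarrow> bool" where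
  "nonneg_combination G V f \<longleftrightarrow>
     (\<exists>c. (\<forall>\<psi>. 0 \<le> c \<psi>) \<and> (\<forall>\<psi>. \<psi> \<notin> V \<longrightarrow> c \<psi> = 0) \<and>
       (\<forall>x\<in>carrier G. f x = (\<Sum>\<psi>\<in>V. complex_of_real (c \<psi>) * \<psi> x)))"

lemma nonneg_combination_add:
  assumes "nonneg_combination G V f" "nonneg_combination G V g"
  shows "nonneg_combination G V (\<lambda>x. f x + g x)"
proof -
  obtain c d where "\<forall>\<psi>. 0 \<le> c \<psi>" "\<forall>\<psi>. \<psi> \<notin> V \<longrightarrow> c \<psi> = 0"
      "\<forall>x\<in>carrier G. f x = (\<Sum>\<psi>\<in>V. complex_of_real (c \<psi>) * \<psi> x)"
      "\<forall>\<psi>. 0 \<le> d \<psi>" "\<forall>\<psi>. \<psi> \<notin> V \<longrightarrow> d \<psi> = 0"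
      "\<forall>x\<in>carrier G. g x = (\<Sum>\<psi>\<in>V. complex_of_real (d \<psi>) * \<psi> x)"
    using assms unfolding nonneg_combination_def by blast
  then show ?thesis unfolding nonneg_combination_def
    by (intro exI[of _ "\<lambda>\<psi>. c \<psi> + d \<psi>"]) (auto simp: distrib_right sum.distrib)
qed

lemma nonneg_combination_zero: "nonneg_combination G V (\<lambda>_. 0)"
  unfolding nonneg_combination_def by (intro exI[of _ "\<lambda>_. 0"]) auto

lemma nonneg_combination_sum:
  assumes "\<And>i. i \<in> I \<Longrightarrow> nonneg_combination G V (f i)"
  shows "nonneg_combination G V (\<lambda>x. \<Sum>i\<in>I. f i x)"
  using assms
  by (induction I rule: infinite_finite_induct) (auto intro: nonneg_combination_zero nonneg_combination_add)

lemma nonneg_combination_scale: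
  assumes "nonneg_combination G V f" "0 \<le> a"
  shows "nonneg_combination G V (\<lambda>x. complex_of_real a * f x)"
proof -
  obtain c where "\<forall>\<psi>. 0 \<le> c \<psi>" "\<forall>\<psi>. \<psi> \<notin> V \<longrightarrow> c \<psi> = 0"
      "\<forall>x\<in>carrier G. f x = (\<Sum>\<psi>\<in>V. complex_of_real (c \<psi>) * \<psi> x)"
    using assms unfolding nonneg_combination_def by blast
  then show ?thesis unfolding nonneg_combination_def using assms(2)
    by (intro exI[of _ "\<lambda>\<psi>. a * c \<psi>"]) (auto simp: sum_distrib_left mult_ac)
qed

lemma nonneg_combination_shift:
  assumes "nonneg_combination G V f" "\<phi> \<in> characters G" "finite V'"
    and V': "\<And>\<psi>. \<psi> \<in> V \<Longrightarrow> (\<lambda>x. \<phi> x * \<psi> x) \<in> V'"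
  shows "nonneg_combination G V' (\<lambda>x. \<phi> x * f x)"
proof -
  obtain c where c: "\<forall>\<psi>. 0 \<le> c \<psi>" "\<forall>\<psi>. \<psi> \<notin> V \<longrightarrow> c \<psi> = 0"
      "\<forall>x\<in>carrier G. f x = (\<Sum>\<psi>\<in>V. complex_of_real (c \<psi>) * \<psi> x)"
    using assms unfolding nonneg_combination_def by blast
  note nz = partial_characters_nonzero[OF assms(2)]
  \<comment> \<open>Multiplication by \<phi> translates the spectrum; \<open>?t\<close> is the
    inverse translation, along which the coefficients are pulled back.\<close>
  let ?s = "\<lambda>\<psi> x. \<phi> x * \<psi> x" and ?t = "\<lambda>\<psi> x. inverse (\<phi> x) * \<psi> x"
  have ts: "?t (?s \<psi>) = \<psi>" and st: "?s (?t \<psi>) = \<psi>" for \<psi> using nz by (auto simp: mult.assoc[symmetric])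
  have inj: "inj_on ?s V" by (rule inj_on_inverseI[of _ ?t]) (rule ts)
  have "\<phi> x * f x = (\<Sum>\<psi>\<in>V'. complex_of_real (c (?t \<psi>)) * \<psi> x)" if x: "x \<in> carrier G" for x
  proof -
    have "(\<Sum>\<psi>\<in>V'. complex_of_real (c (?t \<psi>)) * \<psi> x) = (\<Sum>\<psi>\<in>?s ` V. complex_of_real (c (?t \<psi>)) * \<psi> x)"
    proof (rule sum.mono_neutral_right)
      show "\<forall>\<psi>\<in>V' - ?s ` V. complex_of_real (c (?t \<psi>)) * \<psi> x = 0"
      proof
        fix \<psi> assume \<psi>: "\<psi> \<in> V' - ?s ` V"
        have "?t \<psi> \<notin> V"
        proof
          assume "?t \<psi> \<in> V"
          then have "?s (?t \<psi>) \<in> ?s ` V" by (rule imageI)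
          then show False using \<psi> unfolding st by simp
        qed
        then show "complex_of_real (c (?t \<psi>)) * \<psi> x = 0" using c(2) by simp
      qed
    qed (use assms(3) V' in auto)
    also have "\<dots> = (\<Sum>\<psi>\<in>V. complex_of_real (c \<psi>) * (\<phi> x * \<psi> x))"
      by (simp add: sum.reindex[OF inj] ts)
    also have "\<dots> = \<phi> x * f x" using c(3) x by (simp add: sum_distrib_left mult_ac)
    finally show ?thesis by simp
  qed
  moreover have "c (?t \<psi>) = 0" if "\<psi> \<notin> V'" for \<psi>
    using c(2) V'[of "?t \<psi>"] st[of \<psi>] that by (cases "?t \<psi> \<in> V") auto
  ultimately show ?thesis unfolding nonneg_combination_def using c(1)
    by (intro exI[of _ "\<lambda>\<psi>. c (?t \<psi>)"]) auto
qed

section \<open>Powers of the walk kernel\<close>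

definition monomial_characters :: "('a \<Rightarrow> complex) set \<Rightarrow> nat \<Rightarrow> ('a \<Rightarrow> complex) set" where
  "monomial_characters F N = (\<lambda>v x. \<Prod>\<phi>\<in>F. \<phi> x powi v \<phi>) ` (F \<rightarrow>\<^sub>E {- int N..int N})"

text \<open>The box of exponents contains all positions of an \<open>N\<close>-step walk. Because
  the group is Abelian its size is polynomial in \<open>N\<close>, which geometric decay can
  beat.\<close>

lemma
  assumes "finite F"
  shows finite_monomial_characters: "finite (monomial_characters F N)"
    and card_monomial_characters: "card (monomial_characters F N) \<le> (2 * N + 1) ^ card F"
proof -
  have fin: "finite (F \<rightarrow>\<^sub>E {- int N..int N})" using assms by (intro finite_PiE) auto
  then show "finite (monomial_characters F N)" by (simp add: monomial_characters_def)
  have "card (monomial_characters F N) \<le> card (F \<rightarrow>\<^sub>E {- int N..int N})"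
    unfolding monomial_characters_def by (rule card_image_le[OF fin])
  also have "\<dots> = (2 * N + 1) ^ card F"
    using assms by (simp add: card_PiE nat_add_distrib nat_mult_distrib)
  finally show "card (monomial_characters F N) \<le> (2 * N + 1) ^ card F" .
qed

lemma monomial_characters_subset:
  assumes "finite F" "F \<subseteq> characters G"
  shows "monomial_characters F N \<subseteq> generate (dual G) F"
proof -
  interpret D: comm_group "dual G" by (rule comm_group_dual)
  have F: "F \<subseteq> carrier (dual G)" using assms by simp
  have sg: "subgroup (generate (dual G) F) (dual G)" by (rule D.generate_is_subgroup[OF F])
  have powi: "(\<lambda>x. \<phi> x powi k) \<in> generate (dual G) F" if "\<phi> \<in> F" for \<phi> k
  proof -
    have nat: "(\<lambda>x. \<phi> x ^ n) \<in> generate (dual G) F" for n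
      using D.subgroup_int_pow_closed[OF sg generate.incl[OF that], of "int n"]
      by (simp add: int_pow_int nat_pow_dual)
    show ?thesis
    proof (cases "k \<ge> 0")
      case True
      then show ?thesis using nat[of "nat k"] by (simp add: power_int_nonneg_exp)
    next
      case False
      have "(\<lambda>x. \<phi> x ^ nat (- k)) \<in> characters G" using nat D.generate_incl[OF F] by auto
      then have "(\<lambda>x. inverse (\<phi> x ^ nat (- k))) \<in> generate (dual G) F"
        using subgroup.m_inv_closed[OF sg nat[of "nat (- k)"]] by (simp add: inv_dual)
      then show ?thesis using False by (simp add: power_int_def power_inverse)
    qed
  qed
  have "(\<lambda>x. \<Prod>\<phi>\<in>F'. \<phi> x powi v \<phi>) \<in> generate (dual G) F" if "F' \<subseteq> F" for F' v
    using finite_subset[OF that assms(1)] that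
  proof (induction F' rule: finite_induct)
    case empty
    then show ?case using generate.one[of "dual G" F] by simp
  next
    case (insert \<phi> F')
    then show ?case
      using subgroup.m_closed[OF sg powi[of \<phi> "v \<phi>"], of "\<lambda>x. \<Prod>\<phi>\<in>F'. \<phi> x powi v \<phi>"] by simp
  qed
  then show ?thesis by (auto simp: monomial_characters_def)
qed

lemma monomial_characters_mono: "monomial_characters F N \<subseteq> monomial_characters F (Suc N)"
  unfolding monomial_characters_def by (intro image_mono PiE_mono) auto

lemma monomial_characters_shift:
  assumes "finite F" "\<phi> \<in> F" "\<And>x. \<phi> x \<noteq> 0" "\<psi> \<in> monomial_characters F N" "\<bar>k\<bar> \<le> 1"
  shows "(\<lambda>x. \<phi> x powi k * \<psi> x) \<in> monomial_characters F (Suc N)"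
proof -
  obtain v where v: "v \<in> F \<rightarrow>\<^sub>E {- int N..int N}" "\<psi> = (\<lambda>x. \<Prod>\<phi>\<in>F. \<phi> x powi v \<phi>)"
    using assms(4) by (auto simp: monomial_characters_def)
  define u where "u = v(\<phi> := v \<phi> + k)"
  have "\<phi> x powi k * \<psi> x = (\<Prod>\<phi>\<in>F. \<phi> x powi u \<phi>)" for x
  proof -
    have "(\<Prod>\<phi>\<in>F - {\<phi>}. \<phi> x powi u \<phi>) = (\<Prod>\<phi>\<in>F - {\<phi>}. \<phi> x powi v \<phi>)"
      by (rule prod.cong) (auto simp: u_def)
    then show ?thesis
      using prod.remove[OF assms(1,2), of "\<lambda>\<phi>. \<phi> x powi u \<phi>"] prod.remove[OF assms(1,2), of "\<lambda>\<phi>. \<phi> x powi v \<phi>"]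
        assms(3) by (simp add: u_def v(2) power_int_add mult_ac)
  qed
  moreover have "u \<in> F \<rightarrow>\<^sub>E {- int (Suc N)..int (Suc N)}"
  proof (rule PiE_I)
    fix \<theta> assume "\<theta> \<in> F"
    then have "- int N \<le> v \<theta>" "v \<theta> \<le> int N" using v(1) by auto
    then show "u \<theta> \<in> {- int (Suc N)..int (Suc N)}" using assms(5) by (auto simp: u_def)
  next
    fix \<theta> assume "\<theta> \<notin> F"
    then show "u \<theta> = undefined" using v(1) assms(2) by (auto simp: u_def)
  qed
  ultimately show ?thesis unfolding monomial_characters_def by (intro image_eqI[of _ _ u]) auto
qed

text \<open>This kernel is the Fourier transform of a random walk on the group generated by \<open>F\<close>: it is
  maximal where all characters in \<open>F\<close> are close to 1, while the return probability of the walk,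
  the mean of a power of the kernel, decays only polynomially.\<close>

definition walk_kernel :: "('a \<Rightarrow> complex) set \<Rightarrow> 'a \<Rightarrow> real" where
  "walk_kernel F x = (1 + 2 * (\<Sum>\<phi>\<in>F. Re (\<phi> x))) / (2 * real (card F) + 1)"

lemma unit_inverse_cnj: "norm (z::complex) = 1 \<Longrightarrow> inverse z = cnj z"
  by (rule inverse_unique) (simp flip: complex_norm_square)

text \<open>Multiplying by the kernel is one step of a lazy walk among characters: since
  \<open>2 * Re (\<phi> x)\<close> is the sum of \<open>\<phi> x\<close> and its inverse, the walk
  stays put or multiplies by some \<phi> or its inverse, all with equal weight. Each step enlarges
  the exponent box by one.\<close>

lemma nonneg_combination_walk_kernel_power:
  assumes F: "finite F" "F \<subseteq> characters G"
  shows "nonneg_combination G (monomial_characters F N) (\<lambda>x. complex_of_real (walk_kernel F x ^ N))"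
proof (induction N)
  case 0
  have "monomial_characters F 0 = {\<lambda>_. 1}"
  proof -
    have "(F \<rightarrow>\<^sub>E {- int 0..int 0}) \<noteq> {}" by (auto simp: PiE_eq_empty_iff)
    moreover have "(\<lambda>x. \<Prod>\<phi>\<in>F. \<phi> x powi v \<phi>) = (\<lambda>_. 1)" if "v \<in> F \<rightarrow>\<^sub>E {- int 0..int 0}" for v
    proof -
      have "v \<phi> = 0" if "\<phi> \<in> F" for \<phi> using that \<open>v \<in> _\<close> by (force simp: PiE_iff)
      then show ?thesis by simp
    qed
    ultimately show ?thesis unfolding monomial_characters_def by (auto simp: image_iff)
  qed
  then show ?case unfolding nonneg_combination_def
    by (intro exI[of _ "\<lambda>\<psi>. if \<psi> = (\<lambda>_. 1) then 1 else 0"]) auto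
next
  case (Suc N)
  let ?V = "monomial_characters F (Suc N)" and ?f = "\<lambda>x. complex_of_real (walk_kernel F x ^ N)"
  have finV: "finite ?V" by (rule finite_monomial_characters[OF F(1)])
  have 1: "nonneg_combination G ?V ?f"
    using nonneg_combination_shift[OF Suc trivial_partial_character finV] monomial_characters_mono by auto
  have s: "nonneg_combination G ?V (\<lambda>x. \<phi> x * ?f x)"
    and i: "nonneg_combination G ?V (\<lambda>x. inverse (\<phi> x) * ?f x)" if "\<phi> \<in> F" for \<phi>
  proof -
    have c: "\<phi> \<in> characters G" using that F by auto
    note nz = partial_characters_nonzero[OF c]
    show "nonneg_combination G ?V (\<lambda>x. \<phi> x * ?f x)"
      using monomial_characters_shift[OF F(1) that nz, of _ N 1]
      by (intro nonneg_combination_shift[OF Suc c finV]) simp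
    show "nonneg_combination G ?V (\<lambda>x. inverse (\<phi> x) * ?f x)"
      using monomial_characters_shift[OF F(1) that nz, of _ N "-1"]
      by (intro nonneg_combination_shift[OF Suc characters_inverse[OF c] finV]) (simp add: power_int_minus)
  qed
  have "nonneg_combination G ?V (\<lambda>x. complex_of_real (1 / (2 * real (card F) + 1)) *
     (?f x + (\<Sum>\<phi>\<in>F. \<phi> x * ?f x + inverse (\<phi> x) * ?f x)))"
    by (intro nonneg_combination_scale nonneg_combination_add nonneg_combination_sum 1 s i) auto
  moreover have "complex_of_real (1 / (2 * real (card F) + 1)) *
     (?f x + (\<Sum>\<phi>\<in>F. \<phi> x * ?f x + inverse (\<phi> x) * ?f x)) = complex_of_real (walk_kernel F x ^ Suc N)" for x
  proof -
    have "(\<Sum>\<phi>\<in>F. \<phi> x * ?f x + inverse (\<phi> x) * ?f x) = (\<Sum>\<phi>\<in>F. complex_of_real (2 * Re (\<phi> x)) * ?f x)"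
    proof (rule sum.cong)
      fix \<phi> assume "\<phi> \<in> F"
      then have "norm (\<phi> x) = 1" using partial_characters_norm[OF subsetD[OF F(2)]] by simp
      then have "\<phi> x + inverse (\<phi> x) = complex_of_real (2 * Re (\<phi> x))"
        by (simp add: unit_inverse_cnj complex_add_cnj)
      then show "\<phi> x * ?f x + inverse (\<phi> x) * ?f x = complex_of_real (2 * Re (\<phi> x)) * ?f x"
        by (simp add: distrib_right[symmetric])
    qed simp
    also have "\<dots> = complex_of_real (2 * (\<Sum>\<phi>\<in>F. Re (\<phi> x))) * ?f x"
      by (simp add: sum_distrib_left sum_distrib_right)
    finally show ?thesis
      by (simp only: walk_kernel_def power_Suc) (simp add: field_simps flip: of_real_add of_real_mult of_real_divide)
  qed
  ultimately show ?case by simp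
qed

text \<open>A single character off 1 pulls the kernel down, because the square of
  \<open>norm (z - 1)\<close> is \<open>2 - 2 * Re z\<close> on the circle. The bound from below is
  due to the laziness of the walk, the summand 1 of the kernel: it keeps the kernel away from -1,
  where an even power would be as large as at the unit.\<close>

lemma walk_kernel_bound:
  assumes F: "finite F" "F \<subseteq> characters G" and \<psi>: "\<psi> \<in> F" "\<epsilon> \<le> norm (\<psi> x - 1)"
    and \<epsilon>: "0 < \<epsilon>" "\<epsilon> \<le> 1"
  shows "\<bar>walk_kernel F x\<bar> \<le> 1 - \<epsilon>\<^sup>2 / (2 * real (card F) + 2)"
proof -
  define n where "n = real (card F)"
  have n: "n \<ge> 1" unfolding n_def using F(1) \<psi>(1) by (metis One_nat_def Suc_leI card_gt_0_iff empty_iff of_nat_1 of_nat_le_iff)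
  have norm: "norm (\<phi> x) = 1" if "\<phi> \<in> F" for \<phi>
    using partial_characters_norm[OF subsetD[OF F(2) that]] .
  have Re: "\<bar>Re (\<phi> x)\<bar> \<le> 1" if "\<phi> \<in> F" for \<phi>
    using abs_Re_le_cmod[of "\<phi> x"] norm[OF that] by simp
  have "(norm (\<psi> x - 1))\<^sup>2 = 2 - 2 * Re (\<psi> x)"
  proof -
    have "(Re (\<psi> x))\<^sup>2 + (Im (\<psi> x))\<^sup>2 = 1" using norm[OF \<psi>(1)] by (simp add: cmod_def)
    then show ?thesis by (simp add: cmod_power2) (simp add: power2_eq_square algebra_simps)
  qed
  moreover have "\<epsilon>\<^sup>2 \<le> (norm (\<psi> x - 1))\<^sup>2" using \<psi>(2) \<epsilon>(1) by (intro power_mono) auto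
  ultimately have 1: "Re (\<psi> x) \<le> 1 - \<epsilon>\<^sup>2 / 2" by simp
  have "(\<Sum>\<phi>\<in>F - {\<psi>}. Re (\<phi> x)) \<le> (\<Sum>\<phi>\<in>F - {\<psi>}. 1)"
    using Re by (intro sum_mono) (auto simp: abs_le_iff)
  also have "\<dots> = n - 1" using F(1) \<psi>(1) n by (simp add: n_def)
  finally have upper: "(\<Sum>\<phi>\<in>F. Re (\<phi> x)) \<le> n - \<epsilon>\<^sup>2 / 2"
    using 1 sum.remove[OF F(1) \<psi>(1), of "\<lambda>\<phi>. Re (\<phi> x)"] by simp
  have "(\<Sum>\<phi>\<in>F. - 1) \<le> (\<Sum>\<phi>\<in>F. Re (\<phi> x))" using Re by (intro sum_mono) (force simp: abs_le_iff)
  then have lower: "- n \<le> (\<Sum>\<phi>\<in>F. Re (\<phi> x))" by (simp add: n_def)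
  have e2: "\<epsilon>\<^sup>2 \<le> 1" "0 < \<epsilon>\<^sup>2" using \<epsilon> by (auto simp: power_le_one)
  have "walk_kernel F x \<le> (1 + 2 * (n - \<epsilon>\<^sup>2 / 2)) / (2 * n + 1)"
    unfolding walk_kernel_def n_def[symmetric] using upper n by (intro divide_right_mono) auto
  also have "\<dots> = 1 - \<epsilon>\<^sup>2 / (2 * n + 1)" using n by (simp add: field_simps)
  also have "\<dots> \<le> 1 - \<epsilon>\<^sup>2 / (2 * n + 2)" using n by (intro diff_left_mono divide_left_mono) auto
  finally have up: "walk_kernel F x \<le> 1 - \<epsilon>\<^sup>2 / (2 * n + 2)" .
  have "\<epsilon>\<^sup>2 / (2 * n + 2) \<le> 2 / (2 * n + 1)"
    using n e2 by (intro frac_le) auto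
  then have "- (1 - \<epsilon>\<^sup>2 / (2 * n + 2)) \<le> - 1 + 2 / (2 * n + 1)" by simp
  also have "\<dots> = (1 + 2 * (- n)) / (2 * n + 1)" using n by (simp add: field_simps)
  also have "\<dots> \<le> walk_kernel F x"
    unfolding walk_kernel_def n_def[symmetric] using lower n by (intro divide_right_mono) auto
  finally show ?thesis using up by (simp add: abs_le_iff n_def)
qed

lemma (in comm_group) walk_kernel_one:
  assumes "F \<subseteq> characters G"
  shows "walk_kernel F \<one> = 1"
proof -
  have "(\<Sum>\<phi>\<in>F. Re (\<phi> \<one>)) = (\<Sum>\<phi>\<in>F. 1)"
  proof (rule sum.cong)
    fix \<phi> assume "\<phi> \<in> F"
    then show "Re (\<phi> \<one>) = 1" using partial_characters_one[OF subgroup_self subsetD[OF assms], of \<phi>] by simp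
  qed simp
  then show ?thesis by (simp add: walk_kernel_def)
qed

lemma polynomial_times_geometric_small:
  fixes r \<delta> :: real
  assumes "0 < r" "r < 1" "\<delta> > 0"
  shows "\<exists>N. r ^ (2 * N) * real ((2 * N + 1) ^ n) \<le> \<delta>"
proof -
  have "(\<lambda>N::nat. r ^ (2 * N) * (2 * real N + 1) ^ n) \<longlonglongrightarrow> 0"
    using assms(1,2) by real_asymp
  then have "\<forall>\<^sub>F N in sequentially. r ^ (2 * N) * (2 * real N + 1) ^ n < \<delta>"
    using assms(3) by (rule order_tendstoD)
  then obtain N :: nat where "r ^ (2 * N) * (2 * real N + 1) ^ n < \<delta>"
    by (auto simp: eventually_sequentially)
  then show ?thesis by (intro exI[of _ N]) (simp add: add.commute)
qed

text \<open>Otherwise a power of the kernel times \<open>\<phi>\<close> would have mean almost zero, although that power is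
  concentrated where the real part of \<open>\<phi>\<close> is at least 1/2.\<close>

theorem (in comm_group) character_mem_generate:
  assumes F: "finite F" "F \<subseteq> characters G" and \<phi>: "\<phi> \<in> characters G" and \<epsilon>: "\<epsilon> > 0"
    and near: "\<And>x. x \<in> carrier G \<Longrightarrow> (\<And>\<psi>. \<psi> \<in> F \<Longrightarrow> norm (\<psi> x - 1) < \<epsilon>) \<Longrightarrow> 1 / 2 \<le> Re (\<phi> x)"
  shows "\<phi> \<in> generate (dual G) F"
proof (rule ccontr)
  assume notin: "\<phi> \<notin> generate (dual G) F"
  interpret D: comm_group "dual G" by (rule comm_group_dual)
  have Fc: "F \<subseteq> carrier (dual G)" using F by simp
  have sg: "subgroup (generate (dual G) F) (dual G)" by (rule D.generate_is_subgroup[OF Fc])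
  define n where "n = card F"
  define e where "e = min \<epsilon> 1"
  have e: "0 < e" "e \<le> 1" "e \<le> \<epsilon>" using \<epsilon> by (auto simp: e_def)
  \<comment> \<open>With \<open>2 * real n + 1\<close> as denominator, empty \<open>F\<close> and
    \<open>e = 1\<close> would give the rate 0; this weaker rate is always positive.\<close>
  define r where "r = 1 - e\<^sup>2 / (2 * real n + 2)"
  have e2: "0 < e\<^sup>2" "e\<^sup>2 \<le> 1" using e by (auto simp: power_le_one)
  have r: "0 < r" "r < 1" using e2 by (simp_all add: r_def field_simps)
  \<comment> \<open>The bound 1/12 makes the later error \<open>3 / 2 * r ^ (2 * N)\<close> at most
    \<open>1 / (8 * K)\<close>, the size of \<eta>.\<close>
  obtain N where N: "r ^ (2 * N) * real ((2 * N + 1) ^ n) \<le> 1 / 12"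
    using polynomial_times_geometric_small[OF r, of "1/12" n] by auto
  define K where "K = real ((2 * N + 1) ^ n)"
  have K: "K \<ge> 1" by (simp add: K_def)
  define V where "V = monomial_characters F N"
  have V: "finite V" "V \<subseteq> generate (dual G) F" "real (card V) \<le> K"
    using finite_monomial_characters[OF F(1)] monomial_characters_subset[OF F] card_monomial_characters[OF F(1), of N]
    by (auto simp: V_def K_def n_def simp del: of_nat_power)
  have Vc: "\<psi> \<in> characters G" if "\<psi> \<in> V" for \<psi> using V(2) that D.generate_incl[OF Fc] by auto
  define P where "P = walk_kernel F"
  obtain c where c: "\<And>\<psi>. 0 \<le> c \<psi>"
    and Pc: "\<And>x. x \<in> carrier G \<Longrightarrow> complex_of_real (P x ^ N) = (\<Sum>\<psi>\<in>V. complex_of_real (c \<psi>) * \<psi> x)"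
    using nonneg_combination_walk_kernel_power[OF F, of N] unfolding nonneg_combination_def V_def P_def by blast
  \<comment> \<open>Evaluation at the unit shows that the coefficients form a probability
    distribution, as befits the position of the walk after \<open>N\<close> steps.\<close>
  have sum_c: "(\<Sum>\<psi>\<in>V. c \<psi>) = 1"
  proof -
    have "(\<Sum>\<psi>\<in>V. complex_of_real (c \<psi>)) = (\<Sum>\<psi>\<in>V. complex_of_real (c \<psi>) * \<psi> \<one>)"
      using Vc partial_characters_one[OF subgroup_self] by (intro sum.cong) auto
    also have "\<dots> = 1" using Pc[of \<one>] walk_kernel_one[OF F(2)] by (simp add: P_def)
    finally show ?thesis by (metis of_real_1 of_real_eq_iff of_real_sum)
  qed
  \<comment> \<open>Cauchy-Schwarz: a distribution on at most \<open>K\<close> points has at least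
    this collision probability, which is the return probability after \<open>2 * N\<close>
    steps.\<close>
  have sum_c2: "1 / K \<le> (\<Sum>\<psi>\<in>V. (c \<psi>)\<^sup>2)"
  proof -
    have "1 \<le> (\<Sum>\<psi>\<in>V. (c \<psi>)\<^sup>2) * card V" using sum_squared_le_sum_of_squares[of c V] sum_c by simp
    also have "\<dots> \<le> (\<Sum>\<psi>\<in>V. (c \<psi>)\<^sup>2) * K" using V(3) by (intro mult_left_mono sum_nonneg) auto
    finally show ?thesis using K by (simp add: field_simps)
  qed
  define \<eta> where "\<eta> = 1 / (8 * K)"
  have \<eta>: "\<eta> > 0" using K by (simp add: \<eta>_def)
  define d where "d \<psi> \<theta> = (\<lambda>x. \<psi> x * inverse (\<theta> x))" for \<psi> \<theta> :: "'a \<Rightarrow> complex"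
  have d: "d \<psi> \<theta> \<in> generate (dual G) F" if "\<psi> \<in> V" "\<theta> \<in> V" for \<psi> \<theta>
  proof -
    have "inv\<^bsub>dual G\<^esub> \<theta> \<in> generate (dual G) F" using V(2) that subgroup.m_inv_closed[OF sg] by blast
    then show ?thesis using subgroup.m_closed[OF sg, of \<psi> "inv\<^bsub>dual G\<^esub> \<theta>"] V(2) that inv_dual[OF Vc[OF that(2)]]
      by (auto simp: d_def)
  qed
  have d1: "d \<psi> \<theta> \<noteq> (\<lambda>_. 1)" if "\<psi> \<noteq> \<theta>" "\<theta> \<in> V" for \<psi> \<theta>
  proof
    assume "d \<psi> \<theta> = (\<lambda>_. 1)"
    then have "\<psi> x * inverse (\<theta> x) = 1" for x by (metis d_def)
    then have "\<psi> x = \<theta> x" for x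
      using partial_characters_nonzero[OF Vc[OF that(2)], of x] by (metis divide_inverse divide_eq_1_iff)
    then show False using that by auto
  qed
  \<comment> \<open>All characters whose averages have to be small at once: quotients of members of
    \<open>V\<close>, and such quotients times \<phi>. No product with \<phi> is trivial, because
    \<phi> would then lie in the generated subgroup.\<close>
  define \<Phi> where "\<Phi> = (\<lambda>(\<psi>, \<theta>). d \<psi> \<theta>) ` (V \<times> V) \<union> (\<lambda>(\<psi>, \<theta>) x. d \<psi> \<theta> x * \<phi> x) ` (V \<times> V) - {\<lambda>_. 1}"
  have dc: "d \<psi> \<theta> \<in> characters G" if "\<psi> \<in> V" "\<theta> \<in> V" for \<psi> \<theta>
    using d[OF that] D.generate_incl[OF Fc] by auto
  have d\<phi>: "(\<lambda>x. d \<psi> \<theta> x * \<phi> x) \<noteq> (\<lambda>_. 1)" if "\<psi> \<in> V" "\<theta> \<in> V" for \<psi> \<theta>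
  proof
    assume eq: "(\<lambda>x. d \<psi> \<theta> x * \<phi> x) = (\<lambda>_. 1)"
    have "\<phi> x = inverse (d \<psi> \<theta> x)" for x using inverse_unique[OF fun_cong[OF eq, of x]] by simp
    then have "\<phi> = (\<lambda>x. inverse (d \<psi> \<theta> x))" by blast
    then have "\<phi> \<in> generate (dual G) F"
      using subgroup.m_inv_closed[OF sg d[OF that]] inv_dual[OF dc[OF that]] by simp
    then show False using notin by simp
  qed
  have "finite \<Phi>" using V(1) by (simp add: \<Phi>_def)
  moreover have "\<Phi> \<subseteq> characters G - {\<lambda>_. 1}"
    using dc characters_times[OF dc \<phi>] by (auto simp: \<Phi>_def)
  ultimately obtain L :: nat and g where L: "L > 0" and g: "\<And>i. i < L \<Longrightarrow> g i \<in> carrier G"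
    and mean: "\<And>\<phi>. \<phi> \<in> \<Phi> \<Longrightarrow> norm (\<Sum>i<L. \<phi> (g i)) \<le> \<eta> * L"
    using characters_mean[OF _ _ \<eta>] by metis
  \<comment> \<open>The kernel is real, so its even power is \<open>P x ^ N\<close> times the
    conjugate; this produces the quotients \<open>d\<close>, which are 1 on the diagonal.\<close>
  have expand: "(\<Sum>i<L. complex_of_real (P (g i) ^ (2 * N)) * \<theta> (g i)) =
      (\<Sum>\<psi>\<in>V. \<Sum>\<psi>'\<in>V. complex_of_real (c \<psi> * c \<psi>') * (\<Sum>i<L. d \<psi> \<psi>' (g i) * \<theta> (g i)))" for \<theta>
  proof -
    have "complex_of_real (P x ^ (2 * N)) = (\<Sum>\<psi>\<in>V. \<Sum>\<psi>'\<in>V. complex_of_real (c \<psi> * c \<psi>') * d \<psi> \<psi>' x)"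
      if x: "x \<in> carrier G" for x
    proof -
      have "cnj (complex_of_real (P x ^ N)) = (\<Sum>\<psi>\<in>V. complex_of_real (c \<psi>) * inverse (\<psi> x))"
        unfolding Pc[OF x] using partial_characters_norm[OF Vc]
        by (simp add: unit_inverse_cnj cong: sum.cong)
      then have "complex_of_real (P x ^ (2 * N)) =
        (\<Sum>\<psi>\<in>V. complex_of_real (c \<psi>) * \<psi> x) * (\<Sum>\<psi>\<in>V. complex_of_real (c \<psi>) * inverse (\<psi> x))"
        using Pc[OF x] by (simp add: mult_2 power_add)
      then show ?thesis by (simp add: sum_product d_def mult_ac)
    qed
    then have "(\<Sum>i<L. complex_of_real (P (g i) ^ (2 * N)) * \<theta> (g i)) =
      (\<Sum>i<L. \<Sum>\<psi>\<in>V. \<Sum>\<psi>'\<in>V. complex_of_real (c \<psi> * c \<psi>') * (d \<psi> \<psi>' (g i) * \<theta> (g i)))"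
      using g by (intro sum.cong) (auto simp: sum_distrib_right mult.assoc)
    also have "\<dots> = (\<Sum>\<psi>\<in>V. \<Sum>i<L. \<Sum>\<psi>'\<in>V. complex_of_real (c \<psi> * c \<psi>') * (d \<psi> \<psi>' (g i) * \<theta> (g i)))"
      by (rule sum.swap)
    also have "\<dots> = (\<Sum>\<psi>\<in>V. \<Sum>\<psi>'\<in>V. \<Sum>i<L. complex_of_real (c \<psi> * c \<psi>') * (d \<psi> \<psi>' (g i) * \<theta> (g i)))"
      by (intro sum.cong refl sum.swap)
    finally show ?thesis by (simp add: sum_distrib_left)
  qed
  define A where "A = (\<Sum>i<L. P (g i) ^ (2 * N))"
  define B where "B = (\<Sum>i<L. P (g i) ^ (2 * N) * Re (\<phi> (g i)))"
  \<comment> \<open>The diagonal contributes the sum of squares; all other terms together cost at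
    most \<eta> per sample point, since the coefficients sum to 1.\<close>
  have A_ge: "(1 / K - \<eta>) * L \<le> A"
  proof -
    have "(1 / K - \<eta>) * L \<le> ((\<Sum>\<psi>\<in>V. (c \<psi>)\<^sup>2) - \<eta>) * L" using sum_c2 by (intro mult_right_mono) auto
    also have "\<dots> = (\<Sum>\<psi>\<in>V. \<Sum>\<psi>'\<in>V. c \<psi> * c \<psi>' * ((if \<psi> = \<psi>' then real L else 0) - \<eta> * L))"
    proof -
      have "(\<Sum>\<psi>\<in>V. \<Sum>\<psi>'\<in>V. c \<psi> * c \<psi>' * (if \<psi> = \<psi>' then real L else 0)) = (\<Sum>\<psi>\<in>V. (c \<psi>)\<^sup>2 * L)"
        using V(1) by (intro sum.cong refl) (simp add: if_distrib sum.delta power2_eq_square cong: if_cong)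
      moreover have "(\<Sum>\<psi>\<in>V. \<Sum>\<psi>'\<in>V. c \<psi> * c \<psi>' * (\<eta> * L)) = \<eta> * L"
        using sum_product[of c V c V] sum_c by (simp add: flip: sum_distrib_right)
      ultimately show ?thesis
        by (simp add: right_diff_distrib left_diff_distrib sum_subtractf sum_distrib_right)
    qed
    also have "\<dots> \<le> (\<Sum>\<psi>\<in>V. \<Sum>\<psi>'\<in>V. c \<psi> * c \<psi>' * Re (\<Sum>i<L. d \<psi> \<psi>' (g i)))"
    proof (intro sum_mono mult_left_mono mult_nonneg_nonneg c)
      fix \<psi> \<psi>' assume \<psi>: "\<psi> \<in> V" "\<psi>' \<in> V"
      show "(if \<psi> = \<psi>' then real L else 0) - \<eta> * L \<le> Re (\<Sum>i<L. d \<psi> \<psi>' (g i))"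
      proof (cases "\<psi> = \<psi>'")
        case True
        then have "(\<Sum>i<L. d \<psi> \<psi>' (g i)) = of_nat L"
          using partial_characters_nonzero[OF Vc[OF \<psi>(1)]] by (simp add: d_def)
        then show ?thesis using True \<eta> by simp
      next
        case False
        then have "d \<psi> \<psi>' \<in> \<Phi>" using \<psi> d1[of \<psi> \<psi>'] by (auto simp: \<Phi>_def)
        then have "\<bar>Re (\<Sum>i<L. d \<psi> \<psi>' (g i))\<bar> \<le> \<eta> * L" using mean abs_Re_le_cmod order_trans by blast
        then show ?thesis using False by (simp add: abs_le_iff)
      qed
    qed
    also have "\<dots> = Re (\<Sum>i<L. complex_of_real (P (g i) ^ (2 * N)) * (\<lambda>_. 1) (g i))"
      unfolding expand[of "\<lambda>_. 1"] by simp
    also have "\<dots> = A" by (simp add: A_def)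
    finally show ?thesis .
  qed
  \<comment> \<open>After multiplication by \<phi> even the diagonal terms have small mean.\<close>
  have B_le: "B \<le> \<eta> * L"
  proof -
    have "B = Re (\<Sum>i<L. complex_of_real (P (g i) ^ (2 * N)) * \<phi> (g i))"
      by (simp add: B_def flip: of_real_power)
    also have "\<dots> = (\<Sum>\<psi>\<in>V. \<Sum>\<psi>'\<in>V. c \<psi> * c \<psi>' * Re (\<Sum>i<L. d \<psi> \<psi>' (g i) * \<phi> (g i)))"
      unfolding expand by (simp flip: of_real_mult)
    also have "\<dots> \<le> (\<Sum>\<psi>\<in>V. \<Sum>\<psi>'\<in>V. c \<psi> * c \<psi>' * (\<eta> * L))"
    proof (intro sum_mono mult_left_mono mult_nonneg_nonneg c)
      fix \<psi> \<psi>' assume \<psi>: "\<psi> \<in> V" "\<psi>' \<in> V"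
      then have "(\<lambda>x. d \<psi> \<psi>' x * \<phi> x) \<in> \<Phi>" using d\<phi>[OF \<psi>] by (force simp: \<Phi>_def)
      from mean[OF this] show "Re (\<Sum>i<L. d \<psi> \<psi>' (g i) * \<phi> (g i)) \<le> \<eta> * L"
        using complex_Re_le_cmod order_trans by blast
    qed
    also have "\<dots> = \<eta> * L"
      using sum_product[of c V c V] sum_c by (simp add: flip: sum_distrib_right)
    finally show ?thesis .
  qed
  \<comment> \<open>Where the members of \<open>F\<close> are near 1, \<phi> keeps at least half of
    the kernel power. Elsewhere its real part may be -1, a deficit of \<open>3 / 2\<close> times a
    kernel power that is at most \<open>r ^ (2 * N)\<close>.\<close>
  have AB: "A / 2 - 3 / 2 * r ^ (2 * N) * L \<le> B"
  proof -
    have "P x ^ (2 * N) / 2 - 3 / 2 * r ^ (2 * N) \<le> P x ^ (2 * N) * Re (\<phi> x)" if x: "x \<in> carrier G" for x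
    proof -
      have P0: "0 \<le> P x ^ (2 * N)" by (simp add: power_mult)
      show ?thesis
      proof (cases "\<forall>\<psi>\<in>F. norm (\<psi> x - 1) < \<epsilon>")
        case True
        then have "1 / 2 \<le> Re (\<phi> x)" using near x by blast
        then have "P x ^ (2 * N) * (1 / 2) \<le> P x ^ (2 * N) * Re (\<phi> x)" using P0 by (intro mult_left_mono)
        moreover have "0 \<le> r ^ (2 * N)" using r by simp
        ultimately show ?thesis by linarith
      next
        case False
        then obtain \<psi> where "\<psi> \<in> F" "e \<le> norm (\<psi> x - 1)" using e(3) by force
        then have "\<bar>P x\<bar> \<le> r" unfolding P_def r_def n_def using walk_kernel_bound[OF F] e by blast
        then have "\<bar>P x\<bar> ^ (2 * N) \<le> r ^ (2 * N)" by (intro power_mono) auto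
        then have "P x ^ (2 * N) \<le> r ^ (2 * N)" by (simp add: power_even_abs)
        moreover have "- 1 \<le> Re (\<phi> x)"
          using abs_Re_le_cmod[of "\<phi> x"] partial_characters_norm[OF \<phi>, of x] by linarith
        then have "P x ^ (2 * N) * (- 1) \<le> P x ^ (2 * N) * Re (\<phi> x)" using P0 by (intro mult_left_mono)
        ultimately show ?thesis by simp
      qed
    qed
    then have "(\<Sum>i<L. P (g i) ^ (2 * N) / 2 - 3 / 2 * r ^ (2 * N)) \<le> B"
      unfolding B_def using g by (intro sum_mono) auto
    then show ?thesis by (simp add: A_def sum_subtractf sum_divide_distrib[symmetric] mult_ac)
  qed
  have "(1 / K - \<eta>) * L / 2 - 3 / 2 * r ^ (2 * N) * L \<le> A / 2 - 3 / 2 * r ^ (2 * N) * L"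
    using A_ge by (intro diff_right_mono divide_right_mono) auto
  also have "\<dots> \<le> \<eta> * L" using AB B_le by (rule order_trans)
  finally have "((1 / K - \<eta>) / 2 - 3 / 2 * r ^ (2 * N)) * L \<le> \<eta> * L" by (simp add: left_diff_distrib)
  then have "(1 / K - \<eta>) / 2 - 3 / 2 * r ^ (2 * N) \<le> \<eta>" using L by simp
  moreover have "r ^ (2 * N) * K \<le> 1 / 12" using N unfolding K_def .
  then have "r ^ (2 * N) \<le> 1 / (12 * K)" using K by (simp add: field_simps)
  \<comment> \<open>Multiplied by \<open>16 * K\<close>, this reads 7 - 2 \<le> 2.\<close>
  ultimately have "(1 / K - 1 / (8 * K)) / 2 - 3 / 2 * (1 / (12 * K)) \<le> 1 / (8 * K)"
    unfolding \<eta>_def by linarith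
  then show False using K by (simp add: field_simps)
qed

section \<open>Topologies induced by characters\<close>

definition character_nbhd :: "('a, 'b) monoid_scheme \<Rightarrow> ('a \<Rightarrow> complex) set \<Rightarrow> real \<Rightarrow> 'a \<Rightarrow> 'a set" where
  "character_nbhd G F \<epsilon> x = {y \<in> carrier G. \<forall>\<phi>\<in>F. norm (\<phi> y - \<phi> x) < \<epsilon>}"

text \<open>The initial topology on the carrier for the characters in \<open>B\<close>. Since
  \<open>F\<close> may be empty, the carrier is open even for empty \<open>B\<close>.\<close>

definition character_topology :: "('a, 'b) monoid_scheme \<Rightarrow> ('a \<Rightarrow> complex) set \<Rightarrow> 'a topology" where
  "character_topology G B = topology (\<lambda>U. U \<subseteq> carrier G \<and>
     (\<forall>x\<in>U. \<exists>F \<epsilon>. finite F \<and> F \<subseteq> B \<and> 0 < \<epsilon> \<and> character_nbhd G F \<epsilon> x \<subseteq> U))"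

lemma character_nbhd_mono:
  "F \<subseteq> F' \<Longrightarrow> \<epsilon>' \<le> \<epsilon> \<Longrightarrow> character_nbhd G F' \<epsilon>' x \<subseteq> character_nbhd G F \<epsilon> x"
  by (fastforce simp: character_nbhd_def)

lemma mem_character_nbhd: "x \<in> carrier G \<Longrightarrow> 0 < \<epsilon> \<Longrightarrow> x \<in> character_nbhd G F \<epsilon> x"
  by (simp add: character_nbhd_def)

lemma openin_character_topology:
  "openin (character_topology G B) U \<longleftrightarrow> U \<subseteq> carrier G \<and>
     (\<forall>x\<in>U. \<exists>F \<epsilon>. finite F \<and> F \<subseteq> B \<and> 0 < \<epsilon> \<and> character_nbhd G F \<epsilon> x \<subseteq> U)"
proof -
  let ?P = "\<lambda>U. U \<subseteq> carrier G \<and>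
     (\<forall>x\<in>U. \<exists>F \<epsilon>. finite F \<and> F \<subseteq> B \<and> 0 < \<epsilon> \<and> character_nbhd G F \<epsilon> x \<subseteq> U)"
  have "istopology ?P"
    unfolding istopology_def
  proof (intro conjI allI impI)
    fix S T assume S: "?P S" and T: "?P T"
    show "S \<inter> T \<subseteq> carrier G" using S by blast
    show "\<forall>x\<in>S \<inter> T. \<exists>F \<epsilon>. finite F \<and> F \<subseteq> B \<and> 0 < \<epsilon> \<and> character_nbhd G F \<epsilon> x \<subseteq> S \<inter> T"
    proof
      fix x assume x: "x \<in> S \<inter> T"
      obtain F \<epsilon> where F: "finite F" "F \<subseteq> B" "0 < \<epsilon>" "character_nbhd G F \<epsilon> x \<subseteq> S" using S x by blast
      obtain F' \<epsilon>' where F': "finite F'" "F' \<subseteq> B" "0 < \<epsilon>'" "character_nbhd G F' \<epsilon>' x \<subseteq> T" using T x by blast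
      have "character_nbhd G (F \<union> F') (min \<epsilon> \<epsilon>') x \<subseteq> character_nbhd G F \<epsilon> x"
        "character_nbhd G (F \<union> F') (min \<epsilon> \<epsilon>') x \<subseteq> character_nbhd G F' \<epsilon>' x"
        by (intro character_nbhd_mono; simp)+
      then show "\<exists>F \<epsilon>. finite F \<and> F \<subseteq> B \<and> 0 < \<epsilon> \<and> character_nbhd G F \<epsilon> x \<subseteq> S \<inter> T"
        using F F' by (intro exI[of _ "F \<union> F'"] exI[of _ "min \<epsilon> \<epsilon>'"]) auto
    qed
  next
    fix \<K> assume K: "\<forall>U\<in>\<K>. ?P U"
    then show "\<Union>\<K> \<subseteq> carrier G" by blast
    show "\<forall>x\<in>\<Union>\<K>. \<exists>F \<epsilon>. finite F \<and> F \<subseteq> B \<and> 0 < \<epsilon> \<and> character_nbhd G F \<epsilon> x \<subseteq> \<Union>\<K>"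
    proof
      fix x assume "x \<in> \<Union>\<K>"
      then obtain U where U: "U \<in> \<K>" "x \<in> U" by blast
      then have "?P U" using K by simp
      then obtain F \<epsilon> where F: "finite F" "F \<subseteq> B" "0 < \<epsilon>" "character_nbhd G F \<epsilon> x \<subseteq> U" using U(2) by blast
      have "character_nbhd G F \<epsilon> x \<subseteq> \<Union>\<K>" using F(4) Union_upper[OF U(1)] by (rule subset_trans)
      then show "\<exists>F \<epsilon>. finite F \<and> F \<subseteq> B \<and> 0 < \<epsilon> \<and> character_nbhd G F \<epsilon> x \<subseteq> \<Union>\<K>" using F(1-3) by blast
    qed
  qed
  then show ?thesis unfolding character_topology_def by (simp add: topology_inverse')
qed

lemma openin_character_topologyE:
  assumes "openin (character_topology G B) U" "x \<in> U"
  obtains F \<epsilon> where "finite F" "F \<subseteq> B" "0 < \<epsilon>" "character_nbhd G F \<epsilon> x \<subseteq> U"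
proof -
  have "\<exists>F \<epsilon>. finite F \<and> F \<subseteq> B \<and> 0 < \<epsilon> \<and> character_nbhd G F \<epsilon> x \<subseteq> U"
    using assms(1) unfolding openin_character_topology using assms(2) by simp
  then show thesis using that by blast
qed

lemma topspace_character_topology [simp]: "topspace (character_topology G B) = carrier G"
proof -
  have "openin (character_topology G B) (carrier G)"
    unfolding openin_character_topology
    by (intro conjI ballI exI[of _ "{}"] exI[of _ 1]) (auto simp: character_nbhd_def)
  moreover have "topspace (character_topology G B) \<subseteq> carrier G"
    using openin_topspace[of "character_topology G B"] unfolding openin_character_topology by blast
  ultimately show ?thesis by (meson openin_subset subset_antisym)
qed

lemma openin_character_nbhd:
  assumes "finite F" "F \<subseteq> B"
  shows "openin (character_topology G B) (character_nbhd G F \<epsilon> x)"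
  unfolding openin_character_topology
proof (intro conjI ballI)
  show "character_nbhd G F \<epsilon> x \<subseteq> carrier G" by (auto simp: character_nbhd_def)
  fix y assume y: "y \<in> character_nbhd G F \<epsilon> x"
  \<comment> \<open>The least slack over \<open>F\<close>; the extra 1 keeps the minimum defined
    when \<open>F\<close> is empty.\<close>
  define \<delta> where "\<delta> = Min (insert 1 ((\<lambda>\<phi>. \<epsilon> - norm (\<phi> y - \<phi> x)) ` F))"
  have \<delta>: "\<delta> \<le> \<epsilon> - norm (\<phi> y - \<phi> x)" if "\<phi> \<in> F" for \<phi>
    unfolding \<delta>_def using assms(1) that by (intro Min_le) auto
  have "\<delta> > 0" unfolding \<delta>_def using assms(1) y by (subst Min_gr_iff) (auto simp: character_nbhd_def)
  moreover have "character_nbhd G F \<delta> y \<subseteq> character_nbhd G F \<epsilon> x"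
  proof
    fix z assume z: "z \<in> character_nbhd G F \<delta> y"
    have "norm (\<phi> z - \<phi> x) < \<epsilon>" if "\<phi> \<in> F" for \<phi>
      using norm_triangle_ineq[of "\<phi> z - \<phi> y" "\<phi> y - \<phi> x"] \<delta>[OF that] z that
      by (force simp: character_nbhd_def)
    then show "z \<in> character_nbhd G F \<epsilon> x" using z by (simp add: character_nbhd_def)
  qed
  ultimately show "\<exists>F' \<epsilon>'. finite F' \<and> F' \<subseteq> B \<and> 0 < \<epsilon>' \<and> character_nbhd G F' \<epsilon>' y \<subseteq> character_nbhd G F \<epsilon> x"
    using assms by blast
qed

section \<open>Character topologies as totally bounded Hausdorff group topologies\<close>

context comm_group
begin

lemma characters_mult: "\<phi> \<in> characters G \<Longrightarrow> x \<in> carrier G \<Longrightarrow> y \<in> carrier G \<Longrightarrow> \<phi> (x \<otimes> y) = \<phi> x * \<phi> y"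
  by (rule partial_characters_mult)

lemma characters_inv: "\<phi> \<in> characters G \<Longrightarrow> x \<in> carrier G \<Longrightarrow> \<phi> (inv x) = inverse (\<phi> x)"
  by (rule partial_characters_inv[OF subgroup_self])

lemma characters_one: "\<phi> \<in> characters G \<Longrightarrow> \<phi> \<one> = 1"
  by (rule partial_characters_one[OF subgroup_self])

lemma group_topology_character_topology:
  assumes B: "B \<subseteq> characters G"
  shows "group_topology G (character_topology G B)"
proof -
  let ?T = "character_topology G B"
  have "continuous_map (prod_topology ?T ?T) ?T (\<lambda>(x, y). x \<otimes> y)"
    unfolding continuous_map_def
  proof (intro conjI allI impI)
    show "(\<lambda>(x, y). x \<otimes> y) \<in> topspace (prod_topology ?T ?T) \<rightarrow> topspace ?T" by auto
    fix U assume U: "openin ?T U"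
    show "openin (prod_topology ?T ?T) {p \<in> topspace (prod_topology ?T ?T). (case p of (x, y) \<Rightarrow> x \<otimes> y) \<in> U}"
      unfolding openin_prod_topology_alt
    proof (intro allI impI)
      fix x y assume "(x, y) \<in> {p \<in> topspace (prod_topology ?T ?T). (case p of (x, y) \<Rightarrow> x \<otimes> y) \<in> U}"
      then have xy: "x \<in> carrier G" "y \<in> carrier G" "x \<otimes> y \<in> U" by auto
      then obtain F \<epsilon> where F: "finite F" "F \<subseteq> B" "0 < \<epsilon>" "character_nbhd G F \<epsilon> (x \<otimes> y) \<subseteq> U"
        using openin_character_topologyE[OF U] by metis
      have "x' \<otimes> y' \<in> U" if "x' \<in> character_nbhd G F (\<epsilon> / 2) x" "y' \<in> character_nbhd G F (\<epsilon> / 2) y" for x' y'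
      proof -
        have c: "x' \<in> carrier G" "y' \<in> carrier G" using that by (auto simp: character_nbhd_def)
        have "norm (\<phi> (x' \<otimes> y') - \<phi> (x \<otimes> y)) < \<epsilon>" if "\<phi> \<in> F" for \<phi>
        proof -
          have ch: "\<phi> \<in> characters G" using that F(2) B by blast
          have "\<phi> (x' \<otimes> y') - \<phi> (x \<otimes> y) = \<phi> x' * (\<phi> y' - \<phi> y) + (\<phi> x' - \<phi> x) * \<phi> y"
            using ch c xy by (simp add: characters_mult algebra_simps)
          also have "norm \<dots> \<le> norm (\<phi> y' - \<phi> y) + norm (\<phi> x' - \<phi> x)"
            using norm_triangle_ineq[of "\<phi> x' * (\<phi> y' - \<phi> y)" "(\<phi> x' - \<phi> x) * \<phi> y"] partial_characters_norm[OF ch]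
            by (simp add: norm_mult)
          also have "\<dots> < \<epsilon>"
          proof -
            have "norm (\<phi> y' - \<phi> y) < \<epsilon> / 2" "norm (\<phi> x' - \<phi> x) < \<epsilon> / 2"
              using \<open>x' \<in> character_nbhd G F (\<epsilon> / 2) x\<close> \<open>y' \<in> character_nbhd G F (\<epsilon> / 2) y\<close> that
              by (auto simp: character_nbhd_def)
            then show ?thesis by simp
          qed
          finally show ?thesis .
        qed
        then show ?thesis using F(4) c by (auto simp: character_nbhd_def)
      qed
      then have "character_nbhd G F (\<epsilon> / 2) x \<times> character_nbhd G F (\<epsilon> / 2) y
          \<subseteq> {p \<in> topspace (prod_topology ?T ?T). (case p of (x, y) \<Rightarrow> x \<otimes> y) \<in> U}"
        by (auto simp: character_nbhd_def)
      then show "\<exists>V W. openin ?T V \<and> openin ?T W \<and> x \<in> V \<and> y \<in> W \<and>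
         V \<times> W \<subseteq> {p \<in> topspace (prod_topology ?T ?T). (case p of (x, y) \<Rightarrow> x \<otimes> y) \<in> U}"
        using openin_character_nbhd[OF F(1,2)] mem_character_nbhd[of _ G "\<epsilon> / 2" F] xy F(3)
        by (intro exI[of _ "character_nbhd G F (\<epsilon> / 2) x"] exI[of _ "character_nbhd G F (\<epsilon> / 2) y"]) auto
    qed
  qed
  moreover have "continuous_map ?T ?T (\<lambda>x. inv x)"
    unfolding continuous_map_def
  proof (intro conjI allI impI)
    show "(\<lambda>x. inv x) \<in> topspace ?T \<rightarrow> topspace ?T" by auto
    fix U assume U: "openin ?T U"
    show "openin ?T {x \<in> topspace ?T. inv x \<in> U}"
      unfolding openin_character_topology
    proof (intro conjI ballI)
      fix x assume x: "x \<in> {x \<in> topspace ?T. inv x \<in> U}"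
      then obtain F \<epsilon> where F: "finite F" "F \<subseteq> B" "0 < \<epsilon>" "character_nbhd G F \<epsilon> (inv x) \<subseteq> U"
        using openin_character_topologyE[OF U, of "inv x"] by blast
      have "norm (\<phi> (inv y) - \<phi> (inv x)) = norm (\<phi> y - \<phi> x)" if "\<phi> \<in> F" "y \<in> carrier G" for \<phi> y
      proof -
        have ch: "\<phi> \<in> characters G" using that F(2) B by blast
        \<comment> \<open>On the circle inversion is conjugation, an isometry, so the same
          \<open>F\<close> and \<epsilon> serve.\<close>
        have "\<phi> (inv y) - \<phi> (inv x) = cnj (\<phi> y - \<phi> x)"
          using ch x that partial_characters_norm[OF ch] by (simp add: characters_inv unit_inverse_cnj)
        then show ?thesis by (metis complex_mod_cnj)
      qed
      then have "character_nbhd G F \<epsilon> x \<subseteq> {x \<in> topspace ?T. inv x \<in> U}"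
        using F(4) by (auto simp: character_nbhd_def)
      then show "\<exists>F \<epsilon>. finite F \<and> F \<subseteq> B \<and> 0 < \<epsilon> \<and> character_nbhd G F \<epsilon> x \<subseteq> {x \<in> topspace ?T. inv x \<in> U}"
        using F by blast
    qed auto
  qed
  ultimately show ?thesis by (simp add: group_topology_def)
qed

text \<open>Pigeonhole on the finitely many cells of a grid, with one complex coordinate for each
  member of \<open>F\<close>. The net takes a group element from each occupied cell, so its points
  can act as translations.\<close>

lemma finite_character_net:
  assumes F: "finite F" "F \<subseteq> characters G" and \<epsilon>: "0 < \<epsilon>"
  obtains C where "finite C" "C \<subseteq> carrier G"
    "\<And>x. x \<in> carrier G \<Longrightarrow> \<exists>y\<in>C. x \<in> character_nbhd G F \<epsilon> y"
proof -
  \<comment> \<open>Cells have side \<open>\<epsilon> / 2\<close>, so the differences of real and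
    imaginary parts add up to less than \<epsilon>.\<close>
  define k where "k = 2 / \<epsilon>"
  have k: "0 < k" using \<epsilon> by (simp add: k_def)
  define cell where "cell x = (\<lambda>\<phi>\<in>F. (\<lfloor>k * Re (\<phi> x)\<rfloor>, \<lfloor>k * Im (\<phi> x)\<rfloor>))" for x :: 'a
  define M where "M = {\<lfloor>- k\<rfloor>..\<lfloor>k\<rfloor>}"
  have "cell x \<in> F \<rightarrow>\<^sub>E M \<times> M" for x
  proof -
    have "\<lfloor>k * t\<rfloor> \<in> M" if "\<bar>t\<bar> \<le> 1" for t
    proof -
      have "- k \<le> k * t" "k * t \<le> k" using that k
        by (auto simp: abs_le_iff mult_le_cancel_left1 intro: order_trans[OF _ mult_left_mono[of "-1" t k]])
      then show ?thesis by (auto simp: M_def intro: floor_mono)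
    qed
    moreover have "\<bar>Re (\<phi> x)\<bar> \<le> 1" "\<bar>Im (\<phi> x)\<bar> \<le> 1" if "\<phi> \<in> F" for \<phi>
      using abs_Re_le_cmod[of "\<phi> x"] abs_Im_le_cmod[of "\<phi> x"] partial_characters_norm[OF subsetD[OF F(2) that], of x]
      by simp_all
    ultimately show ?thesis by (auto simp: cell_def)
  qed
  moreover have "finite (F \<rightarrow>\<^sub>E M \<times> M)" using F(1) by (intro finite_PiE) (auto simp: M_def)
  ultimately have "finite (cell ` carrier G)" by (intro finite_subset[of "cell ` carrier G"]) auto
  then obtain C where C: "C \<subseteq> carrier G" "finite C" "cell ` carrier G = cell ` C"
    using finite_subset_image[of "cell ` carrier G" cell "carrier G"] by blast
  have "\<exists>y\<in>C. x \<in> character_nbhd G F \<epsilon> y" if x: "x \<in> carrier G" for x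
  proof -
    obtain y where y: "y \<in> C" "cell x = cell y" using C(3) x by blast
    have "norm (\<phi> x - \<phi> y) < \<epsilon>" if \<phi>: "\<phi> \<in> F" for \<phi>
    proof -
      have "cell x \<phi> = cell y \<phi>" using y by simp
      then have fl: "\<lfloor>k * Re (\<phi> x)\<rfloor> = \<lfloor>k * Re (\<phi> y)\<rfloor>" "\<lfloor>k * Im (\<phi> x)\<rfloor> = \<lfloor>k * Im (\<phi> y)\<rfloor>"
        using \<phi> by (simp_all add: cell_def)
      have close: "\<bar>s - t\<bar> < \<epsilon> / 2" if "\<lfloor>k * s\<rfloor> = \<lfloor>k * t\<rfloor>" for s t :: real
      proof -
        have "\<bar>k * s - k * t\<bar> < 1" using that by linarith
        then have "k * \<bar>s - t\<bar> < 1" using k by (simp add: abs_mult flip: right_diff_distrib)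
        then show ?thesis using \<epsilon> by (simp add: k_def field_simps)
      qed
      have "norm (\<phi> x - \<phi> y) \<le> \<bar>Re (\<phi> x - \<phi> y)\<bar> + \<bar>Im (\<phi> x - \<phi> y)\<bar>" by (rule cmod_le)
      then show ?thesis using close[OF fl(1)] close[OF fl(2)] by simp
    qed
    then show ?thesis using y x by (auto simp: character_nbhd_def)
  qed
  then show thesis using that C by blast
qed

lemma totally_bounded_character_topology:
  assumes B: "B \<subseteq> characters G"
  shows "totally_bounded_topology G (character_topology G B)"
  unfolding totally_bounded_topology_def
proof (intro allI impI)
  fix U assume "neighbourhood_in (character_topology G B) \<one> U"
  then obtain V where V: "openin (character_topology G B) V" "\<one> \<in> V" "V \<subseteq> U"
    by (auto simp: neighbourhood_in_def)
  then obtain F \<epsilon> where F: "finite F" "F \<subseteq> B" "0 < \<epsilon>" "character_nbhd G F \<epsilon> \<one> \<subseteq> U"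
    using openin_character_topologyE[OF V(1,2)] by (metis subset_trans)
  have Fc: "F \<subseteq> characters G" using F B by blast
  obtain C where C: "finite C" "C \<subseteq> carrier G"
    "\<And>x. x \<in> carrier G \<Longrightarrow> \<exists>y\<in>C. x \<in> character_nbhd G F \<epsilon> y"
    using finite_character_net[OF F(1) Fc F(3)] by blast
  have "x \<in> (\<Union>g\<in>insert \<one> C. g <# U)" if x: "x \<in> carrier G" for x
  proof -
    obtain y where y: "y \<in> C" "x \<in> character_nbhd G F \<epsilon> y" using C(3) x by blast
    have yc: "y \<in> carrier G" using y C(2) by blast
    \<comment> \<open>Translation preserves distances between character values, so balls around net
      points are translates of the ball at the unit.\<close>
    have "norm (\<phi> (inv y \<otimes> x) - \<phi> \<one>) < \<epsilon>" if "\<phi> \<in> F" for \<phi>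
    proof -
      have ch: "\<phi> \<in> characters G" using that Fc by blast
      have "\<phi> (inv y \<otimes> x) - \<phi> \<one> = inverse (\<phi> y) * (\<phi> x - \<phi> y)"
        using ch x yc partial_characters_nonzero[OF ch]
        by (simp add: characters_mult characters_inv characters_one right_diff_distrib)
      then have "norm (\<phi> (inv y \<otimes> x) - \<phi> \<one>) = norm (\<phi> x - \<phi> y)"
        using partial_characters_norm[OF ch] by (simp add: norm_mult norm_inverse)
      then show ?thesis using y that by (simp add: character_nbhd_def)
    qed
    then have "inv y \<otimes> x \<in> U" using F(4) x yc by (auto simp: character_nbhd_def)
    moreover have "x = y \<otimes> (inv y \<otimes> x)" using x yc by (simp add: m_assoc[symmetric])
    ultimately show ?thesis using y(1) unfolding l_coset_def by blast
  qed
  then show "\<exists>F. finite F \<and> F \<subseteq> carrier G \<and> \<one> \<in> F \<and> carrier G \<subseteq> (\<Union>g\<in>F. g <# U)"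
    using C(1,2) by (intro exI[of _ "insert \<one> C"]) auto
qed

lemma Hausdorff_character_topology:
  assumes sep: "\<And>x. x \<in> carrier G \<Longrightarrow> x \<noteq> \<one> \<Longrightarrow> \<exists>\<phi>\<in>B. \<phi> x \<noteq> 1" and B: "B \<subseteq> characters G"
  shows "Hausdorff_space (character_topology G B)"
  unfolding Hausdorff_space_def
proof (intro allI impI)
  fix x y assume "x \<in> topspace (character_topology G B) \<and> y \<in> topspace (character_topology G B) \<and> x \<noteq> y"
  then have xy: "x \<in> carrier G" "y \<in> carrier G" "x \<noteq> y" by auto
  have "x \<otimes> inv y \<noteq> \<one>" using xy by (metis inv_equality inv_inv inv_closed)
  then obtain \<phi> where \<phi>: "\<phi> \<in> B" "\<phi> (x \<otimes> inv y) \<noteq> 1" using sep[of "x \<otimes> inv y"] xy by auto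
  have ch: "\<phi> \<in> characters G" using \<phi> B by blast
  have ne: "\<phi> x \<noteq> \<phi> y"
    using \<phi>(2) xy partial_characters_nonzero[OF ch] by (auto simp: characters_mult[OF ch] characters_inv[OF ch])
  define \<epsilon> where "\<epsilon> = norm (\<phi> x - \<phi> y) / 2"
  have "disjnt (character_nbhd G {\<phi>} \<epsilon> x) (character_nbhd G {\<phi>} \<epsilon> y)"
    unfolding disjnt_iff
  proof (intro allI notI, elim conjE)
    fix z assume "z \<in> character_nbhd G {\<phi>} \<epsilon> x" "z \<in> character_nbhd G {\<phi>} \<epsilon> y"
    then show False
      using norm_triangle_ineq4[of "\<phi> z - \<phi> y" "\<phi> z - \<phi> x"] by (simp add: character_nbhd_def \<epsilon>_def)
  qed
  moreover have "0 < \<epsilon>" using ne by (simp add: \<epsilon>_def)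
  ultimately show "\<exists>U V. openin (character_topology G B) U \<and> openin (character_topology G B) V \<and> x \<in> U \<and> y \<in> V \<and> disjnt U V"
    using openin_character_nbhd[of "{\<phi>}" B G] mem_character_nbhd \<phi>(1) xy
    by (intro exI[of _ "character_nbhd G {\<phi>} \<epsilon> x"] exI[of _ "character_nbhd G {\<phi>} \<epsilon> y"]) auto
qed

text \<open>Continuity enters through a single neighbourhood: its radius 1/2 yields the real part of
  at least 1/2 that \<open>character_mem_generate\<close> asks for.\<close>

lemma character_topology_continuous_character:
  assumes B: "B \<subseteq> characters G" and \<phi>: "\<phi> \<in> characters G"
    and U: "openin (character_topology G B) (character_nbhd G {\<phi>} (1 / 2) \<one>)"
  shows "\<phi> \<in> generate (dual G) B"
proof -
  have "\<one> \<in> character_nbhd G {\<phi>} (1 / 2) \<one>" by (rule mem_character_nbhd) auto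
  then obtain F \<epsilon> where F: "finite F" "F \<subseteq> B" "0 < \<epsilon>"
    "character_nbhd G F \<epsilon> \<one> \<subseteq> character_nbhd G {\<phi>} (1 / 2) \<one>"
    using openin_character_topologyE[OF U] by blast
  have Fc: "F \<subseteq> characters G" using F B by blast
  have "\<phi> \<in> generate (dual G) F"
  proof (rule character_mem_generate[OF F(1) Fc \<phi> F(3)])
    fix x assume x: "x \<in> carrier G" "\<And>\<psi>. \<psi> \<in> F \<Longrightarrow> norm (\<psi> x - 1) < \<epsilon>"
    have "norm (\<psi> x - \<psi> \<one>) < \<epsilon>" if "\<psi> \<in> F" for \<psi>
      using characters_one[OF subsetD[OF Fc that]] x(2)[OF that] by simp
    then have "x \<in> character_nbhd G F \<epsilon> \<one>" using x(1) by (simp add: character_nbhd_def)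
    then have "norm (\<phi> x - 1) < 1 / 2" using F(4) characters_one[OF \<phi>] by (auto simp: character_nbhd_def)
    then show "1 / 2 \<le> Re (\<phi> x)" using abs_Re_le_cmod[of "\<phi> x - 1"] by simp
  qed
  moreover have "generate (dual G) F \<subseteq> generate (dual G) B"
    using F(2) comm_group_dual by (intro group.mono_generate) (auto simp: comm_group_def)
  ultimately show ?thesis by blast
qed

section \<open>Distinct topologies from independent characters\<close>

lemma separating_subgroup:
  assumes "infinite (carrier G)"
  obtains S where "subgroup S (dual G)" "S \<lesssim> carrier G"
    "\<And>x. x \<in> carrier G \<Longrightarrow> x \<noteq> \<one> \<Longrightarrow> \<exists>\<phi>\<in>S. \<phi> x \<noteq> 1"
proof -
  interpret D: comm_group "dual G" by (rule comm_group_dual)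
  have "\<exists>\<phi>\<in>characters G. \<phi> x \<noteq> 1" if "x \<in> carrier G - {\<one>}" for x
    using character_separation[OF triv_subgroup, of x] that by blast
  \<comment> \<open>One character for each nontrivial element, so the subgroup they generate is no
    larger than the group.\<close>
  then obtain X where X: "\<And>x. x \<in> carrier G - {\<one>} \<Longrightarrow> X x \<in> characters G \<and> X x x \<noteq> 1" by metis
  let ?R = "X ` (carrier G - {\<one>})"
  have R: "?R \<subseteq> carrier (dual G)" using X by auto
  have "?R \<lesssim> carrier G" by (rule lepoll_trans[OF image_lepoll]) (auto intro: subset_imp_lepoll)
  then have "generate (dual G) ?R \<lesssim> carrier G" by (rule D.generate_lepoll[OF assms R])
  moreover have "\<exists>\<phi>\<in>generate (dual G) ?R. \<phi> x \<noteq> 1" if "x \<in> carrier G" "x \<noteq> \<one>" for x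
    using X[of x] that by (intro bexI[of _ "X x"]) (auto intro: generate.incl)
  ultimately show thesis using that D.generate_is_subgroup[OF R] by blast
qed

lemma Pow_Pow_lepoll_topologies:
  assumes inf: "infinite (carrier G)"
  shows "Pow (Pow (carrier G)) \<lesssim> tb_Hausdorff_group_topologies G"
proof -
  interpret D: comm_group "dual G" by (rule comm_group_dual)
  obtain S where S: "subgroup S (dual G)" "S \<lesssim> carrier G"
    and sep: "\<And>x. x \<in> carrier G \<Longrightarrow> x \<noteq> \<one> \<Longrightarrow> \<exists>\<phi>\<in>S. \<phi> x \<noteq> 1"
    using separating_subgroup[OF inf] by blast
  have "Pow (carrier G) \<lesssim> carrier (dual G)" using Pow_carrier_lepoll_characters[OF inf] by simp
  then obtain I where I: "independent_mod (dual G) S I" and big: "Pow (carrier G) \<lesssim> I"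
    using D.independent_mod_large[OF inf S] by blast
  have Sc: "S \<subseteq> characters G" using subgroup.subset[OF S(1)] by simp
  have Ic: "I \<subseteq> characters G" using I by (auto simp: independent_mod_def)
  let ?T = "\<lambda>Y. character_topology G (S \<union> Y)"
  have sub: "Y \<subseteq> Y'" if Y: "Y \<subseteq> I" "Y' \<subseteq> I" "?T Y = ?T Y'" for Y Y'
  proof (rule subsetI, rule ccontr)
    fix \<phi> assume \<phi>: "\<phi> \<in> Y" "\<phi> \<notin> Y'"
    \<comment> \<open>This ball is open in the first topology, hence in the second, which forces
      \<phi> into the subgroup generated by \<open>S\<close> and \<open>Y'\<close>.\<close>
    have "openin (?T Y) (character_nbhd G {\<phi>} (1 / 2) \<one>)"
      using \<phi> by (intro openin_character_nbhd) auto
    then have "\<phi> \<in> generate (dual G) (S \<union> Y')"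
      using Y Ic Sc \<phi> by (intro character_topology_continuous_character) auto
    moreover have "\<phi> \<notin> generate (dual G) (S \<union> Y')"
      using Y \<phi> by (intro D.independent_modD[OF I]) auto
    ultimately show False by simp
  qed
  have "inj_on ?T (Pow I)"
  proof (rule inj_onI)
    fix Y Y' assume "Y \<in> Pow I" "Y' \<in> Pow I" "?T Y = ?T Y'"
    then show "Y = Y'" using sub[of Y Y'] sub[of Y' Y] by auto
  qed
  moreover have "?T Y \<in> tb_Hausdorff_group_topologies G" if "Y \<in> Pow I" for Y
  proof -
    have c: "S \<union> Y \<subseteq> characters G" using Sc Ic that by auto
    have "Hausdorff_space (?T Y)" using sep by (intro Hausdorff_character_topology[OF _ c]) blast
    then show ?thesis
      using group_topology_character_topology[OF c] totally_bounded_character_topology[OF c]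
      by (simp add: tb_Hausdorff_group_topologies_def)
  qed
  ultimately have "Pow I \<lesssim> tb_Hausdorff_group_topologies G" unfolding lepoll_def by blast
  then show ?thesis by (rule lepoll_trans[OF Pow_lepoll_mono[OF big]])
qed

end

section \<open>Homeomorphism classes\<close>

lemma topologies_on_lepoll: "{T. topspace T = A} \<lesssim> Pow (Pow A)"
proof -
  have "inj_on (\<lambda>T. {U. openin T U}) {T. topspace T = A}"
  proof (rule inj_onI)
    fix T T' :: "'a topology" assume "{U. openin T U} = {U. openin T' U}"
    then show "T = T'" unfolding topology_eq by (metis mem_Collect_eq)
  qed
  moreover have "(\<lambda>T. {U. openin T U}) ` {T. topspace T = A} \<subseteq> Pow (Pow A)"
    by (auto dest: openin_subset)
  ultimately show ?thesis unfolding lepoll_def by blast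
qed

text \<open>A member of the class is coded by the graph of a chosen homeomorphism from
  \<open>T\<close>. Restricted to \<open>A\<close>, the graph is a subset of
  \<open>A \<times> A\<close> and still determines the topology.\<close>

lemma homeomorphism_class_lepoll:
  fixes T :: "'a topology"
  assumes A: "infinite A" and T: "topspace T = A"
  shows "{T'. topspace T' = A \<and> T homeomorphic_space T'} \<lesssim> Pow A"
proof -
  have "\<exists>f. homeomorphic_map T T' f" if "T homeomorphic_space T'" for T' :: "'a topology"
    using that by (simp add: homeomorphic_space)
  then obtain h where h: "\<And>T' :: 'a topology. T homeomorphic_space T' \<Longrightarrow> homeomorphic_map T T' (h T')" by metis
  define g where "g T' = (\<lambda>x. (x, h T' x)) ` A" for T'
  let ?C = "{T'. topspace T' = A \<and> T homeomorphic_space T'}"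
  have "inj_on g ?C"
  proof (rule inj_onI)
    fix T1 T2 assume T1: "T1 \<in> ?C" and T2: "T2 \<in> ?C" and eq: "g T1 = g T2"
    have h_eq: "h T1 x = h T2 x" if "x \<in> A" for x
    proof -
      have "(x, h T1 x) \<in> g T2" using that unfolding eq[symmetric] by (auto simp: g_def)
      then show ?thesis by (auto simp: g_def)
    qed
    \<comment> \<open>A homeomorphism is a quotient map, so \<open>T'\<close> is recovered from
      \<open>T\<close> and the values of \<open>h T'\<close> on \<open>A\<close>.\<close>
    have char: "openin T' U \<longleftrightarrow> U \<subseteq> A \<and> openin T {x \<in> A. h T' x \<in> U}" if "T' \<in> ?C" for T' U
    proof -
      have "quotient_map T T' (h T')" using that h[of T'] by (simp add: homeomorphic_map_def)
      then show ?thesis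
        using that T openin_subset[of T' U] unfolding quotient_map_def by (cases "U \<subseteq> A") auto
    qed
    have "{x \<in> A. h T1 x \<in> U} = {x \<in> A. h T2 x \<in> U}" for U using h_eq by auto
    then show "T1 = T2" unfolding topology_eq using char[OF T1] char[OF T2] by simp
  qed
  moreover have "g ` ?C \<subseteq> Pow (A \<times> A)"
  proof -
    have "g T' \<subseteq> A \<times> A" if "T' \<in> ?C" for T'
      using that homeomorphic_imp_surjective_map[OF h, of T'] T by (auto simp: g_def)
    then show ?thesis by blast
  qed
  ultimately have "?C \<lesssim> Pow (A \<times> A)" unfolding lepoll_def by blast
  also have "Pow (A \<times> A) \<lesssim> Pow A"
    by (intro Pow_lepoll_mono Times_lepoll_infinite A lepoll_refl)
  finally show ?thesis .
qed

text \<open>The classes of the representatives cover the family. By Cantor's theorem there are more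
  than \<open>Pow A\<close> representatives, so \<open>S\<close> itself bounds each class and hence
  their union.\<close>

lemma many_homeomorphism_types:
  fixes \<T> :: "'a topology set"
  assumes A: "infinite A" and \<T>: "\<T> \<subseteq> {T. topspace T = A}" and big: "Pow (Pow A) \<lesssim> \<T>"
  obtains S where "S \<subseteq> \<T>" "Pow (Pow A) \<lesssim> S" "pairwise (\<lambda>T T'. \<not> T homeomorphic_space T') S"
proof -
  define rep where "rep T = (SOME T'. T' \<in> \<T> \<and> T homeomorphic_space T')" for T :: "'a topology"
  have rep: "rep T \<in> \<T> \<and> T homeomorphic_space rep T" if "T \<in> \<T>" for T
    unfolding rep_def by (rule someI[of _ T]) (use that homeomorphic_space_refl in auto)
  \<comment> \<open>Homeomorphic topologies satisfy the same predicate, so the choice operator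
    returns the same representative.\<close>
  have rep_eq: "rep T = rep T'" if "T homeomorphic_space T'" for T T'
  proof -
    have "T homeomorphic_space T'' \<longleftrightarrow> T' homeomorphic_space T''" for T'' :: "'a topology"
      using that homeomorphic_space_sym homeomorphic_space_trans by metis
    then show ?thesis by (simp add: rep_def)
  qed
  define S where "S = rep ` \<T>"
  have S: "S \<subseteq> \<T>" using rep by (auto simp: S_def)
  have "pairwise (\<lambda>T T'. \<not> T homeomorphic_space T') S"
    unfolding pairwise_def
  proof (intro ballI impI notI)
    fix T T' assume *: "T \<in> S" "T' \<in> S" "T \<noteq> T'" "T homeomorphic_space T'"
    then obtain U U' where U: "U \<in> \<T>" "T = rep U" "U' \<in> \<T>" "T' = rep U'" by (auto simp: S_def)
    have "rep U = rep T" "rep U' = rep T'" using U rep by (auto intro: rep_eq)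
    then show False using rep_eq[OF *(4)] *(3) U by simp
  qed
  moreover have "Pow (Pow A) \<lesssim> S"
  proof -
    have "\<T> \<subseteq> (\<Union>T\<in>S. {T'. topspace T' = A \<and> T homeomorphic_space T'})"
    proof
      fix T assume "T \<in> \<T>"
      then show "T \<in> (\<Union>T\<in>S. {T'. topspace T' = A \<and> T homeomorphic_space T'})"
        using rep[of T] homeomorphic_space_sym \<T> by (auto simp: S_def)
    qed
    then have cover: "Pow (Pow A) \<lesssim> (\<Union>T\<in>S. {T'. topspace T' = A \<and> T homeomorphic_space T'})"
      using big subset_imp_lepoll lepoll_trans by blast
    have cls: "{T'. topspace T' = A \<and> T homeomorphic_space T'} \<lesssim> Pow A" if "T \<in> S" for T
      using that S \<T> by (intro homeomorphism_class_lepoll[OF A]) auto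
    have inf: "infinite (Pow A)" using A by simp
    have "\<not> S \<lesssim> Pow A"
    proof
      assume "S \<lesssim> Pow A"
      then have "(\<Union>T\<in>S. {T'. topspace T' = A \<and> T homeomorphic_space T'}) \<lesssim> Pow A"
        using cls by (intro UN_lepoll_infinite[OF inf])
      with cover have "Pow (Pow A) \<lesssim> Pow A" by (rule lepoll_trans)
      then show False by (meson lesspoll_Pow_self lesspoll_not_refl lesspoll_trans1)
    qed
    then have PS: "Pow A \<lesssim> S" using lepoll_linear by blast
    then have "infinite S" using inf finite_lepoll_infinite
      by (meson countable_finite infinite_le_lepoll lepoll_trans)
    then have "(\<Union>T\<in>S. {T'. topspace T' = A \<and> T homeomorphic_space T'}) \<lesssim> S"
      using cls PS lepoll_trans by (intro UN_lepoll_infinite) blast+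
    with cover show ?thesis by (rule lepoll_trans)
  qed
  ultimately show thesis using that S by blast
qed

theorem theorem1p3:
  fixes G :: "('a, 'b) monoid_scheme"
  assumes "comm_group G"
    and "infinite (carrier G)"
  shows "tb_Hausdorff_group_topologies G \<approx> Pow (Pow (carrier G)) \<and>
    (\<exists>S. S \<subseteq> tb_Hausdorff_group_topologies G \<and>
         S \<approx> Pow (Pow (carrier G)) \<and>
         pairwise (\<lambda>T T'. \<not> T homeomorphic_space T') S)"
proof -
  let ?\<T> = "tb_Hausdorff_group_topologies G" and ?P = "Pow (Pow (carrier G))"
  have sub: "?\<T> \<subseteq> {T. topspace T = carrier G}"
    by (auto simp: tb_Hausdorff_group_topologies_def group_topology_def)
  \<comment> \<open>Comparison with all topologies on the carrier, stated for subfamilies so that it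
    also bounds \<open>S\<close>.\<close>
  have upper: "\<S> \<lesssim> ?P" if "\<S> \<subseteq> ?\<T>" for \<S>
    using that sub by (intro lepoll_trans[OF subset_imp_lepoll topologies_on_lepoll]) auto
  have lower: "?P \<lesssim> ?\<T>"
    using comm_group.Pow_Pow_lepoll_topologies assms by blast
  obtain S where S: "S \<subseteq> ?\<T>" "?P \<lesssim> S" "pairwise (\<lambda>T T'. \<not> T homeomorphic_space T') S"
    using many_homeomorphism_types[OF assms(2) sub lower] by blast
  show ?thesis
    using S lepoll_antisym[OF upper lower] lepoll_antisym[OF upper[OF S(1)] S(2)] by blast
qed

end
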